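(* Let $F=F(x,y)$ be a given function. The second order equation $\Omega_F^2[y]=0$, that is, $$y^{(2)}+\left(2F+yF_y\right)y_x+y\left(F^2+F_x\right)=0,$$ is linearizable by a point transformation if and only if $F(x,y)=\alpha(x)\,y+\beta(x)$ for some functions $\alpha$ and $\beta$ of $x$; or equivalently, if and only if, up to a point transformation, the equation is of the same form with $F(x,y)=\alpha(x)\,y$ for some function $\alpha$ of $x$. Moreover, for $F=\alpha(x)\,y$, with $\alpha$ an arbitrary function of $x$, the corresponding equation $$y_{xx}+3\alpha\, y\,y_x+\alpha_x\,y^2+\alpha^2y^3=0$$ has the following family of linearizing transformations $z=\rho(x,y)$, $w=\psi(x,y)$ (mapping it to $w''(z)=0$): $$\rho(x,y)=\frac{x-k_5}{k_3\,y}-k_1+T(x),$$ $$\begin{aligned}\psi(x,y)=Q(x,y)\bigg[&\big((k_5-1)k_4(k_5-x)+k_6(x-1)\big)(x-k_5)\\&-k_3\big((k_5-1)(k_4k_1-k_2)(k_5-x)+k_6k_1(x-1)\big)\,y\\&+k_3\,y\Big[\big((k_5-1)k_4(k_5-x)+k_6(x-1)\big)T(x)+(k_5-1)(k_5-x)\int\frac{k_6\,(k_1-T(x))}{(k_5-x)^2}\,dx\Big]\bigg],\end{aligned}$$ where $$T(x)=\int\frac{(k_5-x)\,\alpha(x)}{k_3}\,dx,\qquad Q(x,y)=\big[(k_5-1)\,k_3\,(k_5-x)\,y\big]^{-1},$$ and $k_1,\dots,k_6$ are arbitrary constants with $k_3k_6\neq0$ and $k_5\neq1$.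
   Context: For a scalar function $F=F(x,y)$, the operator $\Omega_F=\frac{d}{dx}+F(x,y)$ acts, for $y=y(x)$, by $\Omega_F[u]=\frac{du}{dx}+F(x,y(x))\,u$ (the coefficient $F$ always being evaluated at the original unknown $y$). In particular $\Omega_F[y]=y_x+F(x,y)y$, and $\Omega_F^n[y]$ denotes the $n$-fold iterate applied to $y$. The generalized Riccati and Abel chain is the sequence of equations $\Omega_F^n[y]=0$, $n\ge1$. All functions are assumed sufficiently smooth and considered locally, where the expressions are defined (e.g. $y\ne0$, $x\neq k_5$ in the formulas). A point transformation is a locally invertible change of variables $z=\rho(x,y)$, $w=\psi(x,y)$ (nonzero Jacobian) of the independent and dependent variables. An ODE is linearizable by a point transformation if some point transformation maps it to a linear ODE; for second order equations this is the same as being mapped to $w''(z)=0$. Indefinite integrals denote fixed antiderivatives. Subscripts denote derivatives, and $\alpha_x=d\alpha/dx$. *)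

theory Defs
  imports "HOL-Analysis.Analysis"
begin

fun Ck_on :: "nat \<Rightarrow> 'a::real_normed_vector set \<Rightarrow> ('a \<Rightarrow> 'b::real_normed_vector) \<Rightarrow> bool" where
  "Ck_on 0 S f \<longleftrightarrow> continuous_on S f"
| "Ck_on (Suc n) S f \<longleftrightarrow>
     (\<forall>x\<in>S. f differentiable (at x)) \<and> (\<forall>v. Ck_on n S (\<lambda>x. frechet_derivative f (at x) v))"

text \<open>Intended for open sets; values outside the set are irrelevant.\<close>

definition smooth_on :: "'a::real_normed_vector set \<Rightarrow> ('a \<Rightarrow> 'b::real_normed_vector) \<Rightarrow> bool" where
  "smooth_on S f \<longleftrightarrow> (\<forall>n. Ck_on n S f)"

definition pdx :: "(real \<times> real \<Rightarrow> real) \<Rightarrow> real \<times> real \<Rightarrow> real" where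
  "pdx f p = deriv (\<lambda>s. f (s, snd p)) (fst p)"

definition pdy :: "(real \<times> real \<Rightarrow> real) \<Rightarrow> real \<times> real \<Rightarrow> real" where
  "pdy f p = deriv (\<lambda>t. f (fst p, t)) (snd p)"

text \<open>The coefficient of the operator is evaluated along the unknown \<open>y\<close>, also in
  iterates; \<open>u\<close> is the function acted upon.\<close>

definition Omega ::
    "(real \<times> real \<Rightarrow> real) \<Rightarrow> (real \<Rightarrow> real) \<Rightarrow> (real \<Rightarrow> real) \<Rightarrow> real \<Rightarrow> real" where
  "Omega F y u = (\<lambda>x. deriv u x + F (x, y x) * u x)"

text \<open>An ordinary differential equation is represented by the predicate telling whether a
  function satisfies it at a given value of the independent variable.\<close>

type_synonym ode = "(real \<Rightarrow> real) \<Rightarrow> real \<Rightarrow> bool"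

definition riccati_abel_chain :: "(real \<times> real \<Rightarrow> real) \<Rightarrow> nat \<Rightarrow> ode" where
  "riccati_abel_chain F n y x \<longleftrightarrow> ((Omega F y) ^^ n) y x = 0"

definition linear_ode2 :: "(real \<Rightarrow> real) \<Rightarrow> (real \<Rightarrow> real) \<Rightarrow> (real \<Rightarrow> real) \<Rightarrow> ode" where
  "linear_ode2 a b c w z \<longleftrightarrow> deriv (deriv w) z + a z * deriv w z + b z * w z = c z"

definition free_particle_ode :: ode where
  "free_particle_ode w z \<longleftrightarrow> deriv (deriv w) z = 0"

definition point_transformation ::
    "(real \<times> real) set \<Rightarrow> (real \<times> real \<Rightarrow> real) \<Rightarrow> (real \<times> real \<Rightarrow> real) \<Rightarrow> bool" where
  "point_transformation V \<rho> \<psi> \<longleftrightarrow> open V \<and> smooth_on V \<rho> \<and> smooth_on V \<psi> \<and>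
     (\<forall>p\<in>V. pdx \<rho> p * pdy \<psi> p - pdy \<rho> p * pdx \<psi> p \<noteq> 0)"

text \<open>The change of variables \<open>z = \<rho>(x,y)\<close>, \<open>w = \<psi>(x,y)\<close> turns the second order equation
  \<open>E\<close> into \<open>E'\<close>: whenever the graph of \<open>y = y(x)\<close> is carried into the graph of \<open>w = w(z)\<close>,
  \<open>y\<close> satisfies \<open>E\<close> at \<open>x\<close> exactly when \<open>w\<close> satisfies \<open>E'\<close> at the corresponding \<open>z\<close>.
  Near a point \<open>x\<close> such a \<open>w\<close> exists precisely when the total derivative of
  \<open>\<rho>(x,y(x))\<close> does not vanish there.\<close>

definition maps_ode ::
    "(real \<times> real) set \<Rightarrow> (real \<times> real \<Rightarrow> real) \<Rightarrow> (real \<times> real \<Rightarrow> real) \<Rightarrow> ode \<Rightarrow> ode \<Rightarrow> bool" where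
  "maps_ode V \<rho> \<psi> E E' \<longleftrightarrow>
     (\<forall>I J y w. open I \<and> open J \<and> Ck_on 2 I y \<and> Ck_on 2 J w \<and>
        (\<forall>x\<in>I. (x, y x) \<in> V \<and> \<rho> (x, y x) \<in> J \<and> w (\<rho> (x, y x)) = \<psi> (x, y x)) \<longrightarrow>
        (\<forall>x\<in>I. E y x \<longleftrightarrow> E' w (\<rho> (x, y x))))"

definition linearizable_near :: "ode \<Rightarrow> real \<times> real \<Rightarrow> bool" where
  "linearizable_near E p \<longleftrightarrow>
     (\<exists>V \<rho> \<psi> K a b c. p \<in> V \<and> point_transformation V \<rho> \<psi> \<and>
        open K \<and> \<rho> ` V \<subseteq> K \<and> smooth_on K a \<and> smooth_on K b \<and> smooth_on K c \<and>
        maps_ode V \<rho> \<psi> E (linear_ode2 a b c))"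

text \<open>The linearizing family; \<open>T\<close> and \<open>S\<close> stand for the two indefinite integrals.\<close>

definition family_rho ::
    "real \<Rightarrow> real \<Rightarrow> real \<Rightarrow> (real \<Rightarrow> real) \<Rightarrow> real \<times> real \<Rightarrow> real" where
  "family_rho k1 k3 k5 T = (\<lambda>(x, y). (x - k5) / (k3 * y) - k1 + T x)"

definition family_psi ::
    "real \<Rightarrow> real \<Rightarrow> real \<Rightarrow> real \<Rightarrow> real \<Rightarrow> real \<Rightarrow> (real \<Rightarrow> real) \<Rightarrow> (real \<Rightarrow> real)
      \<Rightarrow> real \<times> real \<Rightarrow> real" where
  "family_psi k1 k2 k3 k4 k5 k6 T S = (\<lambda>(x, y).
     inverse ((k5 - 1) * k3 * (k5 - x) * y) *
     (((k5 - 1) * k4 * (k5 - x) + k6 * (x - 1)) * (x - k5)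
      - k3 * ((k5 - 1) * (k4 * k1 - k2) * (k5 - x) + k6 * k1 * (x - 1)) * y
      + k3 * y * (((k5 - 1) * k4 * (k5 - x) + k6 * (x - 1)) * T x
                  + (k5 - 1) * (k5 - x) * S x)))"

end

theory Submission
  imports Defs
begin

text \<open>
  The equation \<open>\<Omega>\<^sub>F\<^sup>2[y] = 0\<close> reads \<open>y'' + A y' + B = 0\<close> with \<open>A = 2 F + y F\<^sub>y\<close> and
  \<open>B = y (F\<^sup>2 + F\<^sub>x)\<close>.  A second order equation that is cubic in \<open>y'\<close> describes the unparametrized
  geodesics of a class of projectively equivalent connections, and point transformations act on such
  equations as changes of coordinates.  Whether an equation can be made linear is therefore decided by the
  curvature of its projective class.  For \<open>y'' + A y' + B = 0\<close> this curvature consists of the two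
  expressions \<open>A\<^sub>y\<^sub>y\<close> and \<open>3 B\<^sub>y\<^sub>y - 2 A\<^sub>x\<^sub>y - 2 A A\<^sub>y\<close>, the invariants of Lie, Liouville and Tresse.

  Necessity.  Comparing the two equations along all curves through a point turns the mapping property into
  four identities between the second derivatives of \<open>\<rho>\<close> and \<open>\<psi>\<close>
  (\<open>maps_ode_coefficients\<close>).  These say that the given connection and the pulled back one differ by
  \<open>\<theta> \<otimes> id + id \<otimes> \<theta>\<close> for a one-form \<open>\<theta>\<close>.  Equality of mixed third derivatives of \<open>\<rho>\<close> and \<open>\<psi>\<close>
  determines all first derivatives of \<open>\<theta>\<close>, and equality of mixed second derivatives of \<open>\<theta>\<close> then
  forces both invariants to vanish as soon as they vanish for the target
  (\<open>lie_invariants_vanish\<close>).  Linear equations and the equations with coefficient \<open>\<alpha>(z) w\<close> are both of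
  the general form with vanishing invariants that occurs in
  \<open>affine_if_mapped_to_linearizable_form\<close>, so one argument serves both equivalences of the theorem.
  For the equation of the chain the vanishing of the invariants forces \<open>F\<^sub>y\<^sub>y = 0\<close>
  (\<open>second_derivative_vanishes\<close>), hence \<open>F = \<alpha>(x) y + \<beta>(x)\<close>.

  Sufficiency.  If \<open>v' = F v\<close> along a solution candidate \<open>y\<close>, then \<open>\<Omega>\<^sub>F[u] = (v u)' / v\<close>, so the equation
  is \<open>(v y)'' = 0\<close>.  For affine \<open>F\<close> the equation \<open>v' = \<beta> v + \<alpha> (v y)\<close> is linear in \<open>v\<close> once \<open>v y = c\<^sub>1 x + c\<^sub>0\<close>
  is known.  With \<open>g = exp (\<integral>\<beta>)\<close>, \<open>m\<^sub>0 = \<integral>\<alpha>/g\<close> and \<open>m\<^sub>1 = \<integral>x\<alpha>/g\<close> the solution curves are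
  \<open>c\<^sub>1 (x - g m\<^sub>1 y) + c\<^sub>0 (1 - g m\<^sub>0 y) = c\<^sub>2 g y\<close>, that is, straight lines in the homogeneous coordinates
  \<open>x - g m\<^sub>1 y : 1 - g m\<^sub>0 y : g y\<close>.  Any choice of affine coordinates on this projective plane straightens
  the solutions.  The denominator \<open>1 - g m\<^sub>0 y\<close> gives the transformation used for affine \<open>F\<close>
  (\<open>linearization\<close>), the denominator \<open>y\<close> (with \<open>g = 1\<close>) the family with the constants
  \<open>k\<^sub>1, \<dots>, k\<^sub>6\<close> (\<open>family_linearizes\<close>).  The normalization \<open>m\<^sub>0(x\<^sub>0) = 0\<close> makes \<open>1 - g m\<^sub>0 y\<close> a legitimate
  denominator near every point, including those with \<open>y = 0\<close>, where the family is undefined.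
\<close>

section \<open>Calculus of smooth functions\<close>

lemma Ck_on_cong:
  assumes "open S" "\<And>x. x \<in> S \<Longrightarrow> f x = g x"
  shows "Ck_on n S f \<longleftrightarrow> Ck_on n S g"
  using assms(2)
proof (induction n arbitrary: f g)
  case 0
  then show ?case by (auto intro: continuous_on_cong)
next
  case (Suc n)
  have *: "(f has_derivative D) (at x) \<longleftrightarrow> (g has_derivative D) (at x)" if "x \<in> S" for x D
    using has_derivative_transform_within_open[OF _ assms(1) that] Suc.prems by metis
  have "frechet_derivative f (at x) = frechet_derivative g (at x)" if "x \<in> S" for x
    unfolding frechet_derivative_def using *[OF that] by simp
  moreover have "f differentiable (at x) \<longleftrightarrow> g differentiable (at x)" if "x \<in> S" for x
    unfolding differentiable_def using *[OF that] by simp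
  ultimately show ?case
    using Suc.IH[of "\<lambda>x. frechet_derivative f (at x) v" "\<lambda>x. frechet_derivative g (at x) v" for v]
    by simp
qed

lemma Ck_on_subset: "Ck_on n S f \<Longrightarrow> T \<subseteq> S \<Longrightarrow> Ck_on n T f"
  by (induction n arbitrary: f) (auto intro: continuous_on_subset)

lemma Ck_on_SucI:
  assumes "open S" "\<And>x. x \<in> S \<Longrightarrow> (f has_derivative D x) (at x)" "\<And>v. Ck_on n S (\<lambda>x. D x v)"
  shows "Ck_on (Suc n) S f"
proof -
  have "frechet_derivative f (at x) = D x" if "x \<in> S" for x
    using frechet_derivative_at[OF assms(2)[OF that]] by simp
  then have "Ck_on n S (\<lambda>x. frechet_derivative f (at x) v)" for v
    using Ck_on_cong[OF assms(1), of "\<lambda>x. frechet_derivative f (at x) v" "\<lambda>x. D x v"] assms(3)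
    by simp
  then show ?thesis using assms(2) by (auto simp: differentiable_def)
qed

lemma Ck_on_SucD: "Ck_on (Suc n) S f \<Longrightarrow> Ck_on n S f"
proof (induction n arbitrary: f)
  case 0
  then show ?case
    by (auto intro!: continuous_at_imp_continuous_on differentiable_imp_continuous_within)
qed auto

lemma Ck_on_mono: "Ck_on n S f \<Longrightarrow> m \<le> n \<Longrightarrow> Ck_on m S f"
  by (induction n) (auto simp: le_Suc_eq intro: Ck_on_SucD simp del: Ck_on.simps)

lemma Ck_on_has_derivative:
  "Ck_on (Suc n) S f \<Longrightarrow> x \<in> S \<Longrightarrow> (f has_derivative frechet_derivative f (at x)) (at x)"
  by (auto simp: frechet_derivative_works)

lemma Ck_on_const: "open S \<Longrightarrow> Ck_on n S (\<lambda>x. c)"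
  by (induction n arbitrary: c) (auto)

lemma Ck_on_bounded_linear: "open S \<Longrightarrow> bounded_linear f \<Longrightarrow> Ck_on n S f"
proof (induction n)
  case 0
  then show ?case by (simp add: linear_continuous_on)
next
  case (Suc n)
  show ?case
    by (rule Ck_on_SucI[where D = "\<lambda>x. f"])
      (use Suc in \<open>auto intro: bounded_linear_imp_has_derivative Ck_on_const\<close>)
qed

lemma Ck_on_add: "open S \<Longrightarrow> Ck_on n S f \<Longrightarrow> Ck_on n S g \<Longrightarrow> Ck_on n S (\<lambda>x. f x + g x)"
proof (induction n arbitrary: f g)
  case 0
  then show ?case by (auto intro: continuous_intros)
next
  case (Suc n)
  show ?case
    by (rule Ck_on_SucI[where D =
          "\<lambda>x v. frechet_derivative f (at x) v + frechet_derivative g (at x) v"])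
      (use Suc in \<open>auto intro!: has_derivative_add simp: frechet_derivative_works[symmetric]\<close>)
qed

lemma Ck_on_mult:
  fixes f g :: "'a::real_normed_vector \<Rightarrow> real"
  shows "open S \<Longrightarrow> Ck_on n S f \<Longrightarrow> Ck_on n S g \<Longrightarrow> Ck_on n S (\<lambda>x. f x * g x)"
proof (induction n arbitrary: f g)
  case 0
  then show ?case by (auto intro: continuous_intros)
next
  case (Suc n)
  have fg: "Ck_on n S f" "Ck_on n S g" using Suc.prems Ck_on_SucD by blast+
  show ?case
    by (rule Ck_on_SucI[where D =
          "\<lambda>x v. f x * frechet_derivative g (at x) v + frechet_derivative f (at x) v * g x"])
      (use Suc fg in \<open>auto intro!: has_derivative_mult Ck_on_add
        simp: frechet_derivative_works[symmetric]\<close>)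
qed

lemma frechet_derivative_real:
  fixes g :: "real \<Rightarrow> real"
  assumes "g differentiable (at x)"
  shows "frechet_derivative g (at x) v = deriv g x * v" "(g has_real_derivative deriv g x) (at x)"
proof -
  show *: "(g has_real_derivative deriv g x) (at x)"
    using assms DERIV_deriv_iff_real_differentiable by blast
  show "frechet_derivative g (at x) v = deriv g x * v"
    using frechet_derivative_at[OF *[unfolded has_field_derivative_def]] by metis
qed

lemma Ck_on_real_Suc:
  fixes g :: "real \<Rightarrow> real"
  assumes "open S"
  shows "Ck_on (Suc n) S g \<longleftrightarrow> (\<forall>x\<in>S. g differentiable (at x)) \<and> Ck_on n S (deriv g)"
proof -
  have "Ck_on n S (\<lambda>x. frechet_derivative g (at x) v) \<longleftrightarrow> Ck_on n S (\<lambda>x. deriv g x * v)"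
    if "\<forall>x\<in>S. g differentiable (at x)" for v
    using that frechet_derivative_real(1) by (intro Ck_on_cong assms) auto
  moreover have "Ck_on n S (deriv g) \<longleftrightarrow> (\<forall>v. Ck_on n S (\<lambda>x. deriv g x * v))"
  proof
    show "\<forall>v. Ck_on n S (\<lambda>x. deriv g x * v)" if "Ck_on n S (deriv g)"
      using that assms by (auto intro: Ck_on_mult Ck_on_const)
    assume "\<forall>v. Ck_on n S (\<lambda>x. deriv g x * v)"
    from this[rule_format, of 1] show "Ck_on n S (deriv g)" by simp
  qed
  ultimately show ?thesis by auto
qed

lemma Ck_on_compose:
  fixes g :: "real \<Rightarrow> real" and f :: "'a::real_normed_vector \<Rightarrow> real"
  assumes "open S" "open K" "f ` S \<subseteq> K" "Ck_on n K g" "Ck_on n S f"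
  shows "Ck_on n S (\<lambda>x. g (f x))"
  using assms(4,5)
proof (induction n arbitrary: g)
  case 0
  then show ?case using assms(3) by (auto intro: continuous_on_compose2)
next
  case (Suc n)
  have f: "Ck_on n S f" and g: "Ck_on n K (deriv g)"
    using Suc.prems Ck_on_SucD Ck_on_real_Suc[OF assms(2)] by blast+
  have *: "Ck_on n S (\<lambda>x. deriv g (f x))" by (rule Suc.IH[OF g f])
  show ?case
  proof (rule Ck_on_SucI[where D = "\<lambda>x v. deriv g (f x) * frechet_derivative f (at x) v"])
    show "open S" by fact
    fix x assume x: "x \<in> S"
    have "(g has_derivative (\<lambda>v. deriv g (f x) * v)) (at (f x))"
      using frechet_derivative_real(2)[of g "f x"] Suc.prems(1) x assms(3)
      by (auto simp: has_field_derivative_def)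
    from has_derivative_compose[OF Ck_on_has_derivative[OF Suc.prems(2) x] this]
    show "((\<lambda>x. g (f x)) has_derivative (\<lambda>v. deriv g (f x) * frechet_derivative f (at x) v)) (at x)"
      by simp
  next
    fix v show "Ck_on n S (\<lambda>x. deriv g (f x) * frechet_derivative f (at x) v)"
      using * Suc.prems(2) by (auto intro: Ck_on_mult assms(1))
  qed
qed

lemma smooth_on_subset: "smooth_on S f \<Longrightarrow> T \<subseteq> S \<Longrightarrow> smooth_on T f"
  unfolding smooth_on_def using Ck_on_subset by blast

lemma smooth_on_cong:
  "open S \<Longrightarrow> (\<And>x. x \<in> S \<Longrightarrow> f x = g x) \<Longrightarrow> smooth_on S f \<longleftrightarrow> smooth_on S g"
  unfolding smooth_on_def using Ck_on_cong by blast

lemma smooth_on_differentiable: "smooth_on S f \<Longrightarrow> x \<in> S \<Longrightarrow> f differentiable (at x)"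
  unfolding smooth_on_def by (metis Ck_on.simps(2))

lemma smooth_on_const: "open S \<Longrightarrow> smooth_on S (\<lambda>x. c)"
  unfolding smooth_on_def using Ck_on_const by blast

lemma smooth_on_bounded_linear: "open S \<Longrightarrow> bounded_linear f \<Longrightarrow> smooth_on S f"
  unfolding smooth_on_def using Ck_on_bounded_linear by blast

lemma smooth_on_add:
  "open S \<Longrightarrow> smooth_on S f \<Longrightarrow> smooth_on S g \<Longrightarrow> smooth_on S (\<lambda>x. f x + g x)"
  unfolding smooth_on_def using Ck_on_add by blast

lemma smooth_on_mult:
  fixes f g :: "'a::real_normed_vector \<Rightarrow> real"
  shows "open S \<Longrightarrow> smooth_on S f \<Longrightarrow> smooth_on S g \<Longrightarrow> smooth_on S (\<lambda>x. f x * g x)"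
  unfolding smooth_on_def using Ck_on_mult by blast

lemma smooth_on_uminus:
  fixes f :: "'a::real_normed_vector \<Rightarrow> real"
  shows "open S \<Longrightarrow> smooth_on S f \<Longrightarrow> smooth_on S (\<lambda>x. - f x)"
  using smooth_on_mult[of S "\<lambda>x. -1" f] smooth_on_const by auto

lemma smooth_on_diff:
  fixes f g :: "'a::real_normed_vector \<Rightarrow> real"
  shows "open S \<Longrightarrow> smooth_on S f \<Longrightarrow> smooth_on S g \<Longrightarrow> smooth_on S (\<lambda>x. f x - g x)"
  using smooth_on_add[of S f "\<lambda>x. - g x"] smooth_on_uminus by auto

lemma smooth_on_power:
  fixes f :: "'a::real_normed_vector \<Rightarrow> real"
  shows "open S \<Longrightarrow> smooth_on S f \<Longrightarrow> smooth_on S (\<lambda>x. f x ^ n)"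
  by (induction n) (auto intro: smooth_on_const smooth_on_mult)

lemma smooth_on_compose:
  fixes g :: "real \<Rightarrow> real" and f :: "'a::real_normed_vector \<Rightarrow> real"
  shows "open S \<Longrightarrow> open K \<Longrightarrow> f ` S \<subseteq> K \<Longrightarrow> smooth_on K g \<Longrightarrow> smooth_on S f
    \<Longrightarrow> smooth_on S (\<lambda>x. g (f x))"
  unfolding smooth_on_def using Ck_on_compose by blast

lemma smooth_on_real_iff:
  fixes g :: "real \<Rightarrow> real"
  assumes "open S"
  shows "smooth_on S g \<longleftrightarrow> (\<forall>x\<in>S. g differentiable (at x)) \<and> smooth_on S (deriv g)"
  unfolding smooth_on_def using Ck_on_real_Suc[OF assms, of _ g] Ck_on_SucD by (metis nat.exhaust)

lemma smooth_on_deriv: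
  fixes g :: "real \<Rightarrow> real"
  shows "open S \<Longrightarrow> smooth_on S g \<Longrightarrow> smooth_on S (deriv g)"
  using smooth_on_real_iff by blast

lemma smooth_on_has_deriv:
  fixes g :: "real \<Rightarrow> real"
  shows "smooth_on S g \<Longrightarrow> x \<in> S \<Longrightarrow> (g has_real_derivative deriv g x) (at x)"
  using smooth_on_differentiable frechet_derivative_real by blast

lemma smooth_on_antiderivative:
  fixes g :: "real \<Rightarrow> real"
  assumes "open S" "\<And>x. x \<in> S \<Longrightarrow> (g has_real_derivative g' x) (at x)" "smooth_on S g'"
  shows "smooth_on S g"
proof -
  have "smooth_on S (deriv g)"
    using smooth_on_cong[OF assms(1), of "deriv g" g'] assms(2,3) DERIV_imp_deriv by blast
  then show ?thesis
    using smooth_on_real_iff[OF assms(1)] assms(2) real_differentiable_def by blast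
qed

text \<open>A solution of an autonomous equation \<open>g' = \<Phi>(g)\<close> with polynomial right-hand side gains one
  derivative at a time; this covers both the exponential and the reciprocal.\<close>

lemma smooth_on_exp: "smooth_on UNIV (exp :: real \<Rightarrow> real)"
proof -
  have "Ck_on n UNIV (exp :: real \<Rightarrow> real)" for n
  proof (induction n)
    case 0
    then show ?case by (simp add: continuous_on_exp)
  next
    case (Suc n)
    moreover have "deriv exp = (exp :: real \<Rightarrow> real)" by (rule ext, rule DERIV_imp_deriv) simp
    moreover have "exp differentiable (at x)" for x :: real
      using DERIV_exp real_differentiable_def by blast
    ultimately show ?case by (simp add: Ck_on_real_Suc del: Ck_on.simps)
  qed
  then show ?thesis by (simp add: smooth_on_def)
qed

lemma smooth_on_inverse_real: "smooth_on (- {0}) (inverse :: real \<Rightarrow> real)"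
proof -
  have op: "open (- {0 :: real})" by auto
  have "Ck_on n (- {0}) (inverse :: real \<Rightarrow> real)" for n
  proof (induction n)
    case 0
    then show ?case by (auto intro: continuous_intros)
  next
    case (Suc n)
    have d: "((inverse :: real \<Rightarrow> real) has_derivative (\<lambda>v. inverse x * inverse x * - v)) (at x)"
      if "x \<in> - {0}" for x
      using DERIV_inverse[of x UNIV] that unfolding has_field_derivative_def
      by (auto elim!: has_derivative_eq_rhs simp: fun_eq_iff power2_eq_square)
    show ?case
      by (rule Ck_on_SucI[OF op d])
       (assumption, intro Ck_on_mult Ck_on_const op Suc)
  qed
  then show ?thesis by (simp add: smooth_on_def)
qed

lemma smooth_on_inverse:
  fixes f :: "'a::real_normed_vector \<Rightarrow> real"
  shows "open S \<Longrightarrow> smooth_on S f \<Longrightarrow> (\<And>x. x \<in> S \<Longrightarrow> f x \<noteq> 0) \<Longrightarrow> smooth_on S (\<lambda>x. inverse (f x))"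
  by (rule smooth_on_compose[where K = "- {0}"]) (auto intro: smooth_on_inverse_real)

lemma smooth_on_divide:
  fixes f g :: "'a::real_normed_vector \<Rightarrow> real"
  assumes "open S" "smooth_on S f" "smooth_on S g" "\<And>x. x \<in> S \<Longrightarrow> g x \<noteq> 0"
  shows "smooth_on S (\<lambda>x. f x / g x)"
  unfolding divide_inverse using assms by (intro smooth_on_mult smooth_on_inverse)

lemma smooth_on_fst: "open S \<Longrightarrow> smooth_on S (fst :: real \<times> real \<Rightarrow> real)"
  by (rule smooth_on_bounded_linear) (auto intro: bounded_linear_fst)

lemma smooth_on_snd: "open S \<Longrightarrow> smooth_on S (snd :: real \<times> real \<Rightarrow> real)"
  by (rule smooth_on_bounded_linear) (auto intro: bounded_linear_snd)

lemma smooth_on_ident: "open S \<Longrightarrow> smooth_on S (\<lambda>x. x)"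
  by (rule smooth_on_bounded_linear) (auto intro: bounded_linear_ident)

lemmas smooth_intros =
  smooth_on_const smooth_on_ident smooth_on_fst smooth_on_snd smooth_on_add smooth_on_diff
  smooth_on_uminus smooth_on_mult smooth_on_power smooth_on_divide smooth_on_inverse

section \<open>Partial derivatives of smooth functions of two variables\<close>

lemma smooth_on_has_derivative_pd:
  fixes f :: "real \<times> real \<Rightarrow> real"
  assumes "smooth_on V f" "p \<in> V"
  shows "(f has_derivative (\<lambda>v. fst v * pdx f p + snd v * pdy f p)) (at p)"
    and "frechet_derivative f (at p) v = fst v * pdx f p + snd v * pdy f p"
proof -
  let ?D = "frechet_derivative f (at p)"
  have D: "(f has_derivative ?D) (at p)"
    using smooth_on_differentiable[OF assms] frechet_derivative_works by blast
  have "((\<lambda>s. f (s, snd p)) has_derivative (\<lambda>v. ?D (v, 0))) (at (fst p))"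
    by (rule has_derivative_compose[where f = "\<lambda>s. (s, snd p)" and g = f and g' = ?D and f' = "\<lambda>v. (v, 0)"])
      (use D in \<open>auto intro!: derivative_eq_intros\<close>)
  moreover have lin: "linear ?D" using D has_derivative_linear by blast
  define a b where "a = ?D (1, 0)" and "b = ?D (0, 1)"
  have sc1: "?D (v, 0) = a * v" for v
    using linear_scale[OF lin, of v "(1, 0)"] by (simp add: a_def)
  have sc2: "?D (0, v) = b * v" for v
    using linear_scale[OF lin, of v "(0, 1)"] by (simp add: b_def)
  ultimately have x: "pdx f p = a"
    unfolding pdx_def by (intro DERIV_imp_deriv) (simp add: has_field_derivative_def sc1)
  have "((\<lambda>s. f (fst p, s)) has_derivative (\<lambda>v. ?D (0, v))) (at (snd p))"
    by (rule has_derivative_compose[where f = "\<lambda>s. (fst p, s)" and g = f and g' = ?D and f' = "\<lambda>v. (0, v)"])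
      (use D in \<open>auto intro!: derivative_eq_intros\<close>)
  then have y: "pdy f p = b"
    unfolding pdy_def by (intro DERIV_imp_deriv) (simp add: has_field_derivative_def sc2)
  show *: "?D v = fst v * pdx f p + snd v * pdy f p" for v
    using linear_add[OF lin, of "(fst v, 0)" "(0, snd v)"] x y sc1[of "fst v"] sc2[of "snd v"]
    by (simp add: mult.commute)
  then have "?D = (\<lambda>v. fst v * pdx f p + snd v * pdy f p)" by (rule ext)
  then show "(f has_derivative (\<lambda>v. fst v * pdx f p + snd v * pdy f p)) (at p)" using D by simp
qed

lemma smooth_on_frechet: "smooth_on V f \<Longrightarrow> smooth_on V (\<lambda>p. frechet_derivative f (at p) v)"
  unfolding smooth_on_def by (metis Ck_on.simps(2))

lemma smooth_on_pdx: "open V \<Longrightarrow> smooth_on V f \<Longrightarrow> smooth_on V (pdx f)"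
  using smooth_on_frechet[of V f "(1, 0)"] smooth_on_has_derivative_pd(2)[of V f _ "(1, 0)"]
    smooth_on_cong[of V "pdx f" "\<lambda>p. frechet_derivative f (at p) (1, 0)"] by simp

lemma smooth_on_pdy: "open V \<Longrightarrow> smooth_on V f \<Longrightarrow> smooth_on V (pdy f)"
  using smooth_on_frechet[of V f "(0, 1)"] smooth_on_has_derivative_pd(2)[of V f _ "(0, 1)"]
    smooth_on_cong[of V "pdy f" "\<lambda>p. frechet_derivative f (at p) (0, 1)"] by simp

lemma smooth_on_along_curve:
  assumes "smooth_on V f" "(x, y x) \<in> V" "(y has_real_derivative y') (at x)"
  shows "((\<lambda>x. f (x, y x)) has_real_derivative (pdx f (x, y x) + y' * pdy f (x, y x))) (at x)"
proof -
  have "((\<lambda>x. (x, y x)) has_derivative (\<lambda>v. (v, v * y'))) (at x)"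
    using assms(3) by (auto intro!: derivative_eq_intros simp: has_field_derivative_def mult.commute)
  from has_derivative_compose[OF this smooth_on_has_derivative_pd(1)[OF assms(1,2)]]
  show ?thesis unfolding has_field_derivative_def
    by (rule has_derivative_eq_rhs) (auto simp: algebra_simps)
qed

lemma has_real_derivative_pdx:
  assumes "smooth_on V f" "(x, y) \<in> V"
  shows "((\<lambda>s. f (s, y)) has_real_derivative pdx f (x, y)) (at x)"
  using smooth_on_along_curve[of V f x "\<lambda>_. y" 0] assms by simp

lemma has_real_derivative_pdy:
  assumes "smooth_on V f" "(x, y) \<in> V"
  shows "((\<lambda>t. f (x, t)) has_real_derivative pdy f (x, y)) (at y)"
proof -
  have "((\<lambda>t. (x, t)) has_derivative (\<lambda>v. (0, v))) (at y)"
    by (auto intro!: derivative_eq_intros)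
  from has_derivative_compose[OF this smooth_on_has_derivative_pd(1)[OF assms(1,2)]]
  show ?thesis unfolding has_field_derivative_def
    by (rule has_derivative_eq_rhs) (auto simp: algebra_simps)
qed

text \<open>The derivative \<open>f\<^sub>x + y' f\<^sub>y\<close> involves \<open>f\<close> and \<open>y\<close> only through functions of the same kind
  with one derivative less of \<open>y\<close>, so the order of differentiability of \<open>y\<close> is inherited.\<close>

lemma Ck_on_along_curve:
  fixes f :: "real \<times> real \<Rightarrow> real" and y :: "real \<Rightarrow> real"
  assumes "open I" "smooth_on V f" "Ck_on n I y" "\<And>x. x \<in> I \<Longrightarrow> (x, y x) \<in> V" and V: "open V"
  shows "Ck_on n I (\<lambda>x. f (x, y x))"
  using assms(2,3)
proof (induction n arbitrary: f)
  case 0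
  have "continuous_on V f" using 0(1) by (metis smooth_on_def Ck_on.simps(1))
  moreover have "continuous_on I (\<lambda>x. (x, y x))" using 0(2) by (auto intro: continuous_intros)
  ultimately show ?case
    using assms(4) continuous_on_compose2[of V f I "\<lambda>x. (x, y x)"] by auto
next
  case (Suc n)
  have y: "\<And>x. x \<in> I \<Longrightarrow> (y has_real_derivative deriv y x) (at x)" "Ck_on n I (deriv y)"
    using Suc.prems(2) frechet_derivative_real(2)
    by (auto simp: Ck_on_real_Suc[OF assms(1)] simp del: Ck_on.simps)
  have "Ck_on n I y" by (rule Ck_on_SucD) (rule Suc.prems(2))
  note y = y this
  have d: "((\<lambda>x. f (x, y x)) has_real_derivative (pdx f (x, y x) + deriv y x * pdy f (x, y x))) (at x)"
    if "x \<in> I" for x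
    using smooth_on_along_curve[OF Suc.prems(1)] assms(4) y(1) that by blast
  have "Ck_on n I (\<lambda>x. pdx f (x, y x) + deriv y x * pdy f (x, y x))"
    using y Suc.prems(1) V
    by (intro Ck_on_add Ck_on_mult Suc.IH assms(1) smooth_on_pdx smooth_on_pdy)
  then have "Ck_on n I (deriv (\<lambda>x. f (x, y x)))"
    using Ck_on_cong[OF assms(1)] d DERIV_imp_deriv by (smt (verit, best))
  then show ?case
    using d real_differentiable_def by (auto simp: Ck_on_real_Suc[OF assms(1)] simp del: Ck_on.simps)
qed

lemma pd_cong:
  assumes "open V" "p \<in> V" "\<forall>q\<in>V. f q = g q"
  shows "pdx f p = pdx g p" "pdy f p = pdy g p"
proof -
  obtain x y where p: "p = (x, y)" by fastforce
  obtain A B where AB: "open A" "open B" "x \<in> A" "y \<in> B" "A \<times> B \<subseteq> V"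
    using assms(1,2) p by (metis open_prod_elim mem_Sigma_iff)
  have "eventually (\<lambda>s. f (s, y) = g (s, y)) (nhds x)"
    using AB assms(3) by (auto simp: eventually_nhds)
  then show "pdx f p = pdx g p"
    unfolding pdx_def by (intro deriv_cong_ev) (auto simp: p)
  have "eventually (\<lambda>t. f (x, t) = g (x, t)) (nhds y)"
    using AB assms(3) by (auto simp: eventually_nhds)
  then show "pdy f p = pdy g p"
    unfolding pdy_def by (intro deriv_cong_ev) (auto simp: p)
qed

text \<open>The second difference of \<open>f\<close> over a small square is, by two applications of the mean value
  theorem, the area times a value of either mixed derivative.\<close>

lemma second_difference_mean_value:
  fixes f :: "real \<times> real \<Rightarrow> real"
  assumes "open V" "smooth_on V f" "h > 0" "{a..a+h} \<times> {b..b+h} \<subseteq> V"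
  defines "\<Delta> \<equiv> f (a+h, b+h) - f (a, b+h) - (f (a+h, b) - f (a, b))"
  shows "\<exists>q\<in>{a..a+h} \<times> {b..b+h}. \<Delta> = h * (h * pdy (pdx f) q)"
    and "\<exists>q\<in>{a..a+h} \<times> {b..b+h}. \<Delta> = h * (h * pdx (pdy f) q)"
proof -
  have "\<exists>\<xi>. \<xi> > a \<and> \<xi> < a + h \<and> (f (a+h, b+h) - f (a+h, b)) - (f (a, b+h) - f (a, b))
      = (a + h - a) * (pdx f (\<xi>, b+h) - pdx f (\<xi>, b))"
    using assms by (intro MVT2 derivative_intros has_real_derivative_pdx) auto
  then obtain \<xi> where \<xi>: "\<xi> > a" "\<xi> < a + h" "\<Delta> = h * (pdx f (\<xi>, b+h) - pdx f (\<xi>, b))"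
    by (auto simp: \<Delta>_def)
  have "\<exists>\<eta>. \<eta> > b \<and> \<eta> < b + h \<and> pdx f (\<xi>, b+h) - pdx f (\<xi>, b) = (b + h - b) * pdy (pdx f) (\<xi>, \<eta>)"
    using assms \<xi> by (intro MVT2 derivative_intros has_real_derivative_pdy[of V])
      (auto intro: smooth_on_pdx)
  then obtain \<eta> where "\<eta> > b" "\<eta> < b + h" "pdx f (\<xi>, b+h) - pdx f (\<xi>, b) = h * pdy (pdx f) (\<xi>, \<eta>)"
    by auto
  with \<xi> show "\<exists>q\<in>{a..a+h} \<times> {b..b+h}. \<Delta> = h * (h * pdy (pdx f) q)"
    by (intro bexI[of _ "(\<xi>, \<eta>)"]) auto
next
  have "\<exists>\<eta>. \<eta> > b \<and> \<eta> < b + h \<and> (f (a+h, b+h) - f (a, b+h)) - (f (a+h, b) - f (a, b))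
      = (b + h - b) * (pdy f (a+h, \<eta>) - pdy f (a, \<eta>))"
    using assms by (intro MVT2 derivative_intros has_real_derivative_pdy) auto
  then obtain \<eta> where \<eta>: "\<eta> > b" "\<eta> < b + h" "\<Delta> = h * (pdy f (a+h, \<eta>) - pdy f (a, \<eta>))"
    by (auto simp: \<Delta>_def)
  have "\<exists>\<xi>. \<xi> > a \<and> \<xi> < a + h \<and> pdy f (a+h, \<eta>) - pdy f (a, \<eta>) = (a + h - a) * pdx (pdy f) (\<xi>, \<eta>)"
    using assms \<eta> by (intro MVT2 derivative_intros has_real_derivative_pdx[of V])
      (auto intro: smooth_on_pdy)
  then obtain \<xi> where "\<xi> > a" "\<xi> < a + h" "pdy f (a+h, \<eta>) - pdy f (a, \<eta>) = h * pdx (pdy f) (\<xi>, \<eta>)"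
    by auto
  with \<eta> show "\<exists>q\<in>{a..a+h} \<times> {b..b+h}. \<Delta> = h * (h * pdx (pdy f) q)"
    by (intro bexI[of _ "(\<xi>, \<eta>)"]) auto
qed

lemma mixed_partials_commute:
  fixes f :: "real \<times> real \<Rightarrow> real"
  assumes V: "open V" and f: "smooth_on V f" and p: "p \<in> V"
  shows "pdy (pdx f) p = pdx (pdy f) p"
proof (rule ccontr)
  obtain a b where ab: "p = (a, b)" by fastforce
  define \<epsilon> where "\<epsilon> = \<bar>pdy (pdx f) p - pdx (pdy f) p\<bar> / 2"
  assume "pdy (pdx f) p \<noteq> pdx (pdy f) p"
  then have \<epsilon>: "\<epsilon> > 0" by (simp add: \<epsilon>_def)
  have cont: "continuous_on V (pdy (pdx f))" "continuous_on V (pdx (pdy f))"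
    using smooth_on_pdx[OF V smooth_on_pdy[OF V f]] smooth_on_pdy[OF V smooth_on_pdx[OF V f]]
    unfolding smooth_on_def by (metis Ck_on.simps(1))+
  \<comment> \<open>On a square inside \<open>W\<close> neither mixed derivative can move by more than half of their supposed gap.\<close>
  define W where "W = {q \<in> V. dist (pdy (pdx f) q) (pdy (pdx f) p) < \<epsilon>}
    \<inter> {q \<in> V. dist (pdx (pdy f) q) (pdx (pdy f) p) < \<epsilon>}"
  have *: "open {q \<in> V. dist (g q) (g p) < \<epsilon>}" if "continuous_on V g" for g :: "real \<times> real \<Rightarrow> real"
  proof -
    have "{q \<in> V. dist (g q) (g p) < \<epsilon>} = V \<inter> g -` ball (g p) \<epsilon>" by (auto simp: dist_commute)
    then show ?thesis using continuous_open_preimage[OF that V open_ball] by simp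
  qed
  have "open W" unfolding W_def using cont by (intro open_Int *)
  moreover have "p \<in> W" using p \<epsilon> by (simp add: W_def)
  ultimately obtain A B where AB: "open A" "open B" "a \<in> A" "b \<in> B" "A \<times> B \<subseteq> W"
    using ab by (metis open_prod_elim mem_Sigma_iff)
  obtain h1 where h1: "h1 > 0" "cball a h1 \<subseteq> A" using AB open_contains_cball by blast
  obtain h2 where h2: "h2 > 0" "cball b h2 \<subseteq> B" using AB open_contains_cball by blast
  define h where "h = min h1 h2"
  have h: "h > 0" "{a..a+h} \<times> {b..b+h} \<subseteq> W"
    using h1 h2 AB(5) by (auto simp: h_def subset_iff dist_real_def)
  have WV: "W \<subseteq> V" by (auto simp: W_def)
  have "{a..a+h} \<times> {b..b+h} \<subseteq> V" using h(2) WV by blast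
  from second_difference_mean_value[OF V f h(1) this] obtain q q'
    where q: "q \<in> {a..a+h} \<times> {b..b+h}" "q' \<in> {a..a+h} \<times> {b..b+h}"
      and "h * (h * pdy (pdx f) q) = h * (h * pdx (pdy f) q')" by metis
  then have eq: "pdy (pdx f) q = pdx (pdy f) q'" using h(1) by simp
  have "q \<in> W" "q' \<in> W" using q h(2) by auto
  then have "dist (pdy (pdx f) q) (pdy (pdx f) p) < \<epsilon>"
    "dist (pdx (pdy f) q') (pdx (pdy f) p) < \<epsilon>" by (auto simp: W_def)
  then show False using eq by (simp add: \<epsilon>_def dist_real_def) argo
qed

text \<open>With the domain fixed, the differentiation rules have side conditions that rewriting can discharge.\<close>

locale plane_domain =
  fixes V :: "(real \<times> real) set"
  assumes open_V: "open V"
begin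

abbreviation "sm \<equiv> smooth_on V"

lemma pd_add:
  "sm f \<Longrightarrow> sm g \<Longrightarrow> p \<in> V \<Longrightarrow> pdx (\<lambda>p. f p + g p) p = pdx f p + pdx g p"
  "sm f \<Longrightarrow> sm g \<Longrightarrow> p \<in> V \<Longrightarrow> pdy (\<lambda>p. f p + g p) p = pdy f p + pdy g p"
  by (cases p; auto simp: pdx_def[of "\<lambda>p. f p + g p"] pdy_def[of "\<lambda>p. f p + g p"]
        intro!: DERIV_imp_deriv DERIV_add has_real_derivative_pdx has_real_derivative_pdy)+

lemma pd_diff:
  "sm f \<Longrightarrow> sm g \<Longrightarrow> p \<in> V \<Longrightarrow> pdx (\<lambda>p. f p - g p) p = pdx f p - pdx g p"
  "sm f \<Longrightarrow> sm g \<Longrightarrow> p \<in> V \<Longrightarrow> pdy (\<lambda>p. f p - g p) p = pdy f p - pdy g p"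
  by (cases p; auto simp: pdx_def[of "\<lambda>p. f p - g p"] pdy_def[of "\<lambda>p. f p - g p"]
        intro!: DERIV_imp_deriv DERIV_diff has_real_derivative_pdx has_real_derivative_pdy)+

lemma pd_mult:
  "sm f \<Longrightarrow> sm g \<Longrightarrow> p \<in> V \<Longrightarrow> pdx (\<lambda>p. f p * g p) p = pdx f p * g p + f p * pdx g p"
  "sm f \<Longrightarrow> sm g \<Longrightarrow> p \<in> V \<Longrightarrow> pdy (\<lambda>p. f p * g p) p = pdy f p * g p + f p * pdy g p"
  by (cases p; auto simp: pdx_def[of "\<lambda>p. f p * g p"] pdy_def[of "\<lambda>p. f p * g p"]
        intro!: DERIV_imp_deriv DERIV_mult'[THEN DERIV_cong] has_real_derivative_pdx has_real_derivative_pdy)+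

lemma pd_divide_const:
  "sm f \<Longrightarrow> p \<in> V \<Longrightarrow> pdx (\<lambda>p. f p / c) p = pdx f p / c"
  "sm f \<Longrightarrow> p \<in> V \<Longrightarrow> pdy (\<lambda>p. f p / c) p = pdy f p / c"
  by (cases p; auto simp: pdx_def[of "\<lambda>p. f p / c"] pdy_def[of "\<lambda>p. f p / c"]
        intro!: DERIV_imp_deriv DERIV_cdivide has_real_derivative_pdx has_real_derivative_pdy)+

lemma pd_const: "pdx (\<lambda>p. c) = (\<lambda>p. 0)" "pdy (\<lambda>p. c) = (\<lambda>p. 0)"
  by (auto simp: pdx_def pdy_def)

lemma pd_power2:
  "sm f \<Longrightarrow> p \<in> V \<Longrightarrow> pdx (\<lambda>p. (f p)\<^sup>2) p = 2 * f p * pdx f p"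
  "sm f \<Longrightarrow> p \<in> V \<Longrightarrow> pdy (\<lambda>p. (f p)\<^sup>2) p = 2 * f p * pdy f p"
  by (simp_all add: power2_eq_square pd_mult)

lemma pd_proj: "pdx fst = (\<lambda>p. 1)" "pdy fst = (\<lambda>p. 0)" "pdx snd = (\<lambda>p. 0)" "pdy snd = (\<lambda>p. 1)"
  by (auto simp: pdx_def pdy_def)

lemma pd_compose:
  fixes g :: "real \<Rightarrow> real"
  assumes "sm f" "p \<in> V" "g differentiable (at (f p))"
  shows "pdx (\<lambda>p. g (f p)) p = deriv g (f p) * pdx f p" "pdy (\<lambda>p. g (f p)) p = deriv g (f p) * pdy f p"
proof -
  obtain x y where p: "p = (x, y)" by fastforce
  have g: "(g has_real_derivative deriv g (f (x, y))) (at (f (x, y)))"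
    using frechet_derivative_real(2) assms(3) p by simp
  show "pdx (\<lambda>p. g (f p)) p = deriv g (f p) * pdx f p"
    using DERIV_chain2[OF g has_real_derivative_pdx[of V f x y]] assms p
    unfolding pdx_def[of "\<lambda>p. g (f p)"] by (auto intro!: DERIV_imp_deriv)
  show "pdy (\<lambda>p. g (f p)) p = deriv g (f p) * pdy f p"
    using DERIV_chain2[OF g has_real_derivative_pdy[of V f x y]] assms p
    unfolding pdy_def[of "\<lambda>p. g (f p)"] by (auto intro!: DERIV_imp_deriv)
qed

lemmas sm_intros = smooth_intros[OF open_V] smooth_on_pdx[OF open_V] smooth_on_pdy[OF open_V]
lemmas pd_rules = pd_divide_const pd_add pd_diff pd_mult pd_const pd_power2 pd_proj

end

section \<open>Curves and change of parameter\<close>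

lemma Ck_on_real_D:
  fixes y :: "real \<Rightarrow> real"
  assumes "open I" "Ck_on (Suc n) I y"
  shows "\<And>x. x \<in> I \<Longrightarrow> (y has_real_derivative deriv y x) (at x)" "Ck_on n I (deriv y)"
  using assms frechet_derivative_real(2) by (auto simp: Ck_on_real_Suc simp del: Ck_on.simps)

lemma Ck_on_2_D:
  fixes y :: "real \<Rightarrow> real"
  assumes "open I" "Ck_on 2 I y" "x \<in> I"
  shows "(y has_real_derivative deriv y x) (at x)" "(deriv y has_real_derivative deriv (deriv y) x) (at x)"
proof -
  have 1: "Ck_on (Suc (Suc 0)) I y" using assms(2) by (simp add: numeral_2_eq_2 del: Ck_on.simps)
  show "(y has_real_derivative deriv y x) (at x)" by (rule Ck_on_real_D(1)[OF assms(1) 1 assms(3)])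
  show "(deriv y has_real_derivative deriv (deriv y) x) (at x)"
    by (rule Ck_on_real_D(1)[OF assms(1) Ck_on_real_D(2)[OF assms(1) 1] assms(3)])
qed

lemma deriv_along_curve:
  assumes "open V" "smooth_on V f" "open I" "Ck_on 2 I y" "\<And>x. x \<in> I \<Longrightarrow> (x, y x) \<in> V" "x \<in> I"
  shows "deriv (\<lambda>x. f (x, y x)) x = pdx f (x, y x) + deriv y x * pdy f (x, y x)"
    and "deriv (deriv (\<lambda>x. f (x, y x))) x =
      pdx (pdx f) (x, y x) + 2 * deriv y x * pdx (pdy f) (x, y x)
      + (deriv y x)\<^sup>2 * pdy (pdy f) (x, y x) + deriv (deriv y) x * pdy f (x, y x)"
proof -
  note y = Ck_on_2_D[OF assms(3,4)]
  have 1: "deriv (\<lambda>x. f (x, y x)) x = pdx f (x, y x) + deriv y x * pdy f (x, y x)"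
    if "x \<in> I" for x
    using assms that by (intro DERIV_imp_deriv smooth_on_along_curve y) auto
  have f: "smooth_on V (pdx f)" "smooth_on V (pdy f)"
    using assms smooth_on_pdx smooth_on_pdy by blast+
  have "((\<lambda>x. pdx f (x, y x) + deriv y x * pdy f (x, y x)) has_real_derivative
      (pdx (pdx f) (x, y x) + deriv y x * pdy (pdx f) (x, y x)
       + (deriv (deriv y) x * pdy f (x, y x)
       + (pdx (pdy f) (x, y x) + deriv y x * pdy (pdy f) (x, y x)) * deriv y x))) (at x)"
    using assms(5,6) y
    by (intro DERIV_add DERIV_mult smooth_on_along_curve[OF f(1)] smooth_on_along_curve[OF f(2)]) auto
  moreover have "eventually (\<lambda>x. x \<in> I) (nhds x)"
    using assms(3,6) by (auto simp: eventually_nhds)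
  then have "deriv (deriv (\<lambda>x. f (x, y x))) x = deriv (\<lambda>x. pdx f (x, y x) + deriv y x * pdy f (x, y x)) x"
    by (intro deriv_cong_ev) (auto elim: eventually_mono simp: 1)
  ultimately show "deriv (deriv (\<lambda>x. f (x, y x))) x =
      pdx (pdx f) (x, y x) + 2 * deriv y x * pdx (pdy f) (x, y x)
      + (deriv y x)\<^sup>2 * pdy (pdy f) (x, y x) + deriv (deriv y) x * pdy f (x, y x)"
    using mixed_partials_commute[OF assms(1,2)] assms(5,6) DERIV_imp_deriv
    by (fastforce simp: algebra_simps power2_eq_square)
  show "deriv (\<lambda>x. f (x, y x)) x = pdx f (x, y x) + deriv y x * pdy f (x, y x)"
    using 1 assms(6) by simp
qed

text \<open>These are the chain rules that relate the jets of \<open>w\<close> to the jets of the two coordinates of the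
  transformed curve \<open>x \<mapsto> (h x, g x)\<close>.\<close>

lemma deriv_reparametrized:
  fixes w h g :: "real \<Rightarrow> real"
  assumes I: "open I" and J: "open J" and w: "Ck_on 2 J w" and h: "Ck_on 2 I h" and hJ: "h ` I \<subseteq> J"
    and g: "\<And>x. x \<in> I \<Longrightarrow> w (h x) = g x" and x: "x \<in> I"
  shows "deriv g x = deriv w (h x) * deriv h x"
    and "deriv (deriv g) x = deriv (deriv w) (h x) * (deriv h x)\<^sup>2 + deriv w (h x) * deriv (deriv h) x"
proof -
  note w' = Ck_on_2_D[OF J w] and h' = Ck_on_2_D[OF I h]
  have ev: "eventually (\<lambda>x. x \<in> I) (nhds x)" if "x \<in> I" for x
    using I that by (auto simp: eventually_nhds)
  have 1: "deriv g x = deriv w (h x) * deriv h x" if "x \<in> I" for x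
  proof -
    have "deriv g x = deriv (\<lambda>x. w (h x)) x"
      using ev[OF that] by (intro deriv_cong_ev) (auto elim: eventually_mono simp: g)
    also have "\<dots> = deriv w (h x) * deriv h x"
      using that hJ by (intro DERIV_imp_deriv DERIV_chain2 w' h') auto
    finally show ?thesis .
  qed
  show "deriv g x = deriv w (h x) * deriv h x" by (rule 1[OF x])
  have "deriv (deriv g) x = deriv (\<lambda>x. deriv w (h x) * deriv h x) x"
    using ev[OF x] by (intro deriv_cong_ev) (auto elim: eventually_mono simp: 1)
  also have "\<dots> = deriv (deriv w) (h x) * deriv h x * deriv h x + deriv (deriv h) x * deriv w (h x)"
    using x hJ by (intro DERIV_imp_deriv DERIV_mult DERIV_chain2 w' h') auto
  finally show "deriv (deriv g) x = deriv (deriv w) (h x) * (deriv h x)\<^sup>2 + deriv w (h x) * deriv (deriv h) x"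
    by (simp add: power2_eq_square)
qed

text \<open>Since \<open>k' = 1 / h'(k)\<close>, each derivative that \<open>k\<close> is known to have yields the next one, until those
  of \<open>h'\<close> are exhausted.\<close>

lemma Ck_on_inverse_function:
  fixes h k :: "real \<Rightarrow> real"
  assumes I: "open I" and J: "open (h ` I)"
    and k: "\<And>x. x \<in> I \<Longrightarrow> k (h x) = x" and nz: "\<And>x. x \<in> I \<Longrightarrow> deriv h x \<noteq> 0"
    and h: "Ck_on (Suc n) I h"
  shows "Ck_on (Suc n) (h ` I) k"
proof -
  have h1: "(h has_real_derivative deriv h x) (at x)" if "x \<in> I" for x
    using that Ck_on_real_D(1)[OF I h] by blast
  have conth: "continuous_on I h"
    using h1 DERIV_isCont by (auto intro!: continuous_at_imp_continuous_on)
  have k1: "(k has_real_derivative inverse (deriv h (k z))) (at z)" if "z \<in> h ` I" for z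
  proof -
    from that obtain x where x: "x \<in> I" "z = h x" by blast
    have "(k has_derivative (\<lambda>v. inverse (deriv h x) * v)) (at (h x))"
      by (rule has_derivative_inverse_strong[OF I x(1) conth k h1[OF x(1), unfolded has_field_derivative_def]])
        (use nz[OF x(1)] in \<open>auto simp: fun_eq_iff\<close>)
    then show ?thesis using x k by (simp add: has_field_derivative_def)
  qed
  have kI: "k ` (h ` I) \<subseteq> I" using k by auto
  have "Ck_on m (h ` I) k \<Longrightarrow> m \<le> n \<Longrightarrow> Ck_on (Suc m) (h ` I) k" for m
  proof -
    assume m: "Ck_on m (h ` I) k" "m \<le> n"
    have "Ck_on n I (deriv h)" by (rule Ck_on_real_D(2)[OF I h])
    then have "Ck_on m I (deriv h)" using m(2) by (rule Ck_on_mono)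
    then have "Ck_on m (h ` I) (\<lambda>z. deriv h (k z))" by (rule Ck_on_compose[OF J I kI _ m(1)])
    moreover have "Ck_on m (- {0}) (inverse :: real \<Rightarrow> real)"
      using smooth_on_inverse_real unfolding smooth_on_def by blast
    moreover have "open (- {0 :: real})" by auto
    moreover have "(\<lambda>z. deriv h (k z)) ` (h ` I) \<subseteq> - {0}" using nz k by auto
    ultimately have "Ck_on m (h ` I) (\<lambda>z. inverse (deriv h (k z)))"
      using Ck_on_compose[OF J] by blast
    moreover have "deriv k z = inverse (deriv h (k z))" if "z \<in> h ` I" for z
      using k1[OF that] DERIV_imp_deriv by blast
    ultimately have "Ck_on m (h ` I) (deriv k)"
      using Ck_on_cong[OF J, of "deriv k" "\<lambda>z. inverse (deriv h (k z))" m] by blast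
    then show ?thesis
      using k1 real_differentiable_def by (auto simp: Ck_on_real_Suc[OF J] simp del: Ck_on.simps)
  qed
  note step = this
  have "Ck_on m (h ` I) k" if "m \<le> Suc n" for m
    using that
  proof (induction m)
    case 0
    show ?case
      using k1 DERIV_isCont by (auto intro!: continuous_at_imp_continuous_on)
  next
    case (Suc m)
    then show ?case using step[of m] by (simp del: Ck_on.simps)
  qed
  then show ?thesis by blast
qed

text \<open>A parametrized curve \<open>(h, g)\<close> is a graph \<open>w = w(z)\<close> near each point where \<open>h' \<noteq> 0\<close>, of the same
  order of differentiability.  This supplies the functions \<open>w\<close> on which a change of variables is tested.\<close>

lemma local_reparametrization:
  fixes h g :: "real \<Rightarrow> real"
  assumes I: "open I" and x0: "x0 \<in> I" and h: "Ck_on (Suc n) I h" and g: "Ck_on (Suc n) I g"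
    and nz: "deriv h x0 \<noteq> 0"
  obtains I' w where "open I'" "x0 \<in> I'" "I' \<subseteq> I" "open (h ` I')" "Ck_on (Suc n) (h ` I') w"
    "\<And>x. x \<in> I' \<Longrightarrow> w (h x) = g x"
proof -
  have h1: "(h has_real_derivative deriv h x) (at x)" if "x \<in> I" for x
    using that Ck_on_real_D(1)[OF I h] by blast
  have "Ck_on n I (deriv h)" by (rule Ck_on_real_D(2)[OF I h])
  then have "Ck_on 0 I (deriv h)" by (rule Ck_on_mono) simp
  then have "continuous_on I (deriv h)" by simp
  then have "open (I \<inter> deriv h -` (- {0}))" by (intro continuous_open_preimage I) auto
  then obtain e where e: "e > 0" "ball x0 e \<subseteq> I \<inter> deriv h -` (- {0})"
    using x0 nz openE by (metis ComplI IntI singletonD vimageI)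
  define I' where "I' = ball x0 e"
  have I': "open I'" "x0 \<in> I'" "I' \<subseteq> I" "\<And>x. x \<in> I' \<Longrightarrow> deriv h x \<noteq> 0" "convex I'"
    using e by (auto simp: I'_def)
  have conth: "continuous_on I' h"
    using h1 I'(3) by (intro continuous_at_imp_continuous_on ballI DERIV_isCont) blast
  have neq: "h a \<noteq> h b" if "a \<in> I'" "b \<in> I'" "a < b" for a b
  proof
    assume eq: "h a = h b"
    have sub: "{a..b} \<subseteq> I'" using that I'(5) by (metis closed_segment_eq_real_ivl closed_segment_subset less_imp_le)
    have "\<exists>z. z > a \<and> z < b \<and> h b - h a = (b - a) * deriv h z"
      using that sub I'(3) h1 by (intro MVT2) (auto simp: subset_iff)
    then obtain z where "a < z" "z < b" "deriv h z = 0" using eq \<open>a < b\<close> by auto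
    moreover from this have "z \<in> I'" using sub by auto
    ultimately show False using I'(4) by blast
  qed
  then have inj: "inj_on h I'" by (metis inj_onI linorder_neqE_linordered_idom)
  have J: "open (h ` I')"
    using injective_into_1d_imp_open_map_UNIV[OF I'(1) conth inj] by simp
  define k where "k = inv_into I' h"
  have k: "k (h x) = x" if "x \<in> I'" for x using that inj by (simp add: k_def)
  have "Ck_on (Suc n) (h ` I') k"
    by (rule Ck_on_inverse_function[OF I'(1) J k I'(4) Ck_on_subset[OF h I'(3)]])
  then have "Ck_on (Suc n) (h ` I') (\<lambda>z. g (k z))"
    using k by (intro Ck_on_compose[OF J I'(1) _ Ck_on_subset[OF g I'(3)]]) auto
  then show ?thesis using that[OF I'(1,2,3) J, of "\<lambda>z. g (k z)"] k by simp
qed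

section \<open>Point transformations acting on second order equations\<close>

text \<open>The excluded slope is at most one value of \<open>p\<close>; multiplication by the linear factor that vanishes
  there turns the hypothesis into a quartic identity valid for all \<open>p\<close>.\<close>

lemma cubic_coefficients_vanish:
  fixes rx ry e0 e1 e2 e3 :: real
  assumes "\<And>p. rx + p * ry \<noteq> 0 \<Longrightarrow> e0 + e1 * p + e2 * p\<^sup>2 + e3 * p ^ 3 = 0" "rx \<noteq> 0 \<or> ry \<noteq> 0"
  shows "e0 = 0" "e1 = 0" "e2 = 0" "e3 = 0"
proof -
  define a0 a1 a2 a3 a4 where a: "a0 = rx * e0" "a1 = rx * e1 + ry * e0" "a2 = rx * e2 + ry * e1"
    "a3 = rx * e3 + ry * e2" "a4 = ry * e3"
  have *: "a0 + a1 * p + a2 * p\<^sup>2 + a3 * p ^ 3 + a4 * p ^ 4 = 0" for p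
  proof -
    have "a0 + a1 * p + a2 * p\<^sup>2 + a3 * p ^ 3 + a4 * p ^ 4
      = (rx + p * ry) * (e0 + e1 * p + e2 * p\<^sup>2 + e3 * p ^ 3)"
      by (simp add: a algebra_simps power2_eq_square power3_eq_cube power4_eq_xxxx)
    then show ?thesis using assms(1)[of p] by auto
  qed
  have "a0 = 0" "a1 = 0" "a2 = 0" "a3 = 0" "a4 = 0"
    using *[of 0] *[of 1] *[of "-1"] *[of 2] *[of "-2"] by simp_all
  then have 0: "rx * e0 = 0" and 1: "rx * e1 + ry * e0 = 0" and 2: "rx * e2 + ry * e1 = 0"
    and 3: "rx * e3 + ry * e2 = 0" and 4: "ry * e3 = 0" by (simp_all add: a)
  show "e0 = 0" "e1 = 0" "e2 = 0" "e3 = 0"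
    using 0 1 2 3 4 assms(2) by (cases "rx = 0"; force)+
qed

text \<open>Substituting \<open>w' = (\<psi>\<^sub>x + m \<psi>\<^sub>y) / (\<rho>\<^sub>x + m \<rho>\<^sub>y)\<close> and the corresponding expression for \<open>w''\<close> into the
  target equation gives an equation for \<open>y''\<close> that is cubic in the slope \<open>m\<close>.  It has to be a multiple of
  \<open>y'' + A m + B = 0\<close>, and the identities compare the coefficients.  The abbreviations \<open>sxx\<close>, \<open>sxy\<close>, \<open>syy\<close>
  are the second derivatives of \<open>\<psi>\<close> corrected by the pulled back Christoffel symbols of the target.\<close>

lemma maps_ode_coefficients:
  fixes \<rho> \<psi> A B P Q :: "real \<times> real \<Rightarrow> real"
  assumes pt: "point_transformation V \<rho> \<psi>" and maps: "maps_ode V \<rho> \<psi> E E'"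
    and E: "\<And>I y x. open I \<Longrightarrow> Ck_on 2 I y \<Longrightarrow> (\<And>x. x \<in> I \<Longrightarrow> (x, y x) \<in> V) \<Longrightarrow> x \<in> I \<Longrightarrow>
      E y x \<longleftrightarrow> deriv (deriv y) x + A (x, y x) * deriv y x + B (x, y x) = 0"
    and E': "\<And>J w z. open J \<Longrightarrow> Ck_on 2 J w \<Longrightarrow> J \<subseteq> \<rho> ` V \<Longrightarrow> z \<in> J \<Longrightarrow>
      E' w z \<longleftrightarrow> deriv (deriv w) z + P (z, w z) * deriv w z + Q (z, w z) = 0"
    and pV: "p \<in> V"
  defines "rx \<equiv> pdx \<rho> p" and "ry \<equiv> pdy \<rho> p" and "sx \<equiv> pdx \<psi> p" and "sy \<equiv> pdy \<psi> p"
    and "rxx \<equiv> pdx (pdx \<rho>) p" and "rxy \<equiv> pdx (pdy \<rho>) p" and "ryy \<equiv> pdy (pdy \<rho>) p"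
    and "P0 \<equiv> P (\<rho> p, \<psi> p)" and "Q0 \<equiv> Q (\<rho> p, \<psi> p)"
  defines "sxx \<equiv> pdx (pdx \<psi>) p + P0 * rx * sx + Q0 * rx\<^sup>2"
    and "sxy \<equiv> pdx (pdy \<psi>) p + P0 / 2 * (rx * sy + ry * sx) + Q0 * rx * ry"
    and "syy \<equiv> pdy (pdy \<psi>) p + P0 * ry * sy + Q0 * ry\<^sup>2"
  shows "(rx * sy - ry * sx) * B p = rx * sxx - sx * rxx"
    and "(rx * sy - ry * sx) * A p = ry * sxx - sy * rxx + 2 * (rx * sxy - sx * rxy)"
    and "rx * syy - sx * ryy + 2 * (ry * sxy - sy * rxy) = 0"
    and "ry * syy = sy * ryy"
proof -
  obtain x0 y0 where p: "p = (x0, y0)" by fastforce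
  have V: "open V" and \<rho>: "smooth_on V \<rho>" and \<psi>: "smooth_on V \<psi>" and J0: "rx * sy - ry * sx \<noteq> 0"
    using pt pV by (auto simp: point_transformation_def rx_def ry_def sx_def sy_def)
  have cubic: "(rx * sxx - sx * rxx - (rx * sy - ry * sx) * B p)
      + (ry * sxx - sy * rxx + 2 * (rx * sxy - sx * rxy) - (rx * sy - ry * sx) * A p) * m
      + (rx * syy - sx * ryy + 2 * (ry * sxy - sy * rxy)) * m\<^sup>2 + (ry * syy - sy * ryy) * m ^ 3 = 0"
    if D: "rx + m * ry \<noteq> 0" for m
  proof -
    \<comment> \<open>A parabola through \<open>p\<close> with slope \<open>m\<close> whose second derivative there is the one prescribed by \<open>E\<close>.\<close>
    define q where "q = - (A p * m + B p)"
    define y where "y = (\<lambda>x. y0 + m * (x - x0) + q / 2 * (x - x0)\<^sup>2)"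
    have y': "(y has_real_derivative m + q * (x - x0)) (at x)" for x
      unfolding y_def by (auto intro!: derivative_eq_intros)
    then have dy: "deriv y = (\<lambda>x. m + q * (x - x0))" using DERIV_imp_deriv by blast
    have "((\<lambda>x. m + q * (x - x0)) has_real_derivative q) (at x)" for x
      by (auto intro!: derivative_eq_intros)
    then have ddy: "deriv (deriv y) x = q" for x unfolding dy using DERIV_imp_deriv by blast
    have smy: "smooth_on UNIV y" unfolding y_def by (intro smooth_intros open_UNIV) simp
    define I where "I = (\<lambda>x. (x, y x)) -` V"
    have "continuous_on UNIV (\<lambda>x. (x, y x))" unfolding y_def by (intro continuous_intros)
    then have I: "open I" unfolding I_def by (intro open_vimage V)
    have x0: "x0 \<in> I" using pV p by (simp add: I_def y_def)
    have yI: "Ck_on 2 I y" using smy Ck_on_subset unfolding smooth_on_def by blast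
    have IV: "\<And>x. x \<in> I \<Longrightarrow> (x, y x) \<in> V" by (simp add: I_def)
    have y0: "y x0 = y0" by (simp add: y_def)
    let ?h = "\<lambda>x. \<rho> (x, y x)" and ?g = "\<lambda>x. \<psi> (x, y x)"
    have h: "Ck_on 2 I ?h" and g: "Ck_on 2 I ?g"
      using Ck_on_along_curve[OF I _ yI IV V] \<rho> \<psi> by blast+
    note hd = deriv_along_curve[OF V \<rho> I yI IV x0] and gd = deriv_along_curve[OF V \<psi> I yI IV x0]
    have h1: "deriv ?h x0 = rx + m * ry" using hd(1) by (simp add: dy y0 p rx_def ry_def)
    with D have nz: "deriv ?h x0 \<noteq> 0" by simp
    obtain I' w where I': "open I'" "x0 \<in> I'" "I' \<subseteq> I" "open (?h ` I')" "Ck_on 2 (?h ` I') w"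
      "\<And>x. x \<in> I' \<Longrightarrow> w (?h x) = ?g x"
      by (rule local_reparametrization[OF I x0 h[folded Suc_1] g[folded Suc_1] nz, unfolded Suc_1]) blast
    have "E y x0 \<longleftrightarrow> E' w (?h x0)"
      using I' IV
      by (intro maps[unfolded maps_ode_def, rule_format, of I' "?h ` I'" y w]
          conjI ballI Ck_on_subset[OF yI I'(3)]) auto
    moreover have "E y x0"
      using E[OF I yI IV x0] unfolding ddy by (simp add: dy q_def p y0)
    moreover have "E' w (?h x0) \<longleftrightarrow>
      deriv (deriv w) (?h x0) + P (?h x0, w (?h x0)) * deriv w (?h x0) + Q (?h x0, w (?h x0)) = 0"
      using I' IV by (intro E'[OF I'(4,5)]) auto
    ultimately have w2: "deriv (deriv w) (?h x0) + P0 * deriv w (?h x0) + Q0 = 0"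
      using I'(6)[OF I'(2)] by (simp add: P0_def Q0_def p y0)
    note wd = deriv_reparametrized[OF I'(1,4,5) Ck_on_subset[OF h I'(3)] order_refl I'(6) I'(2)]
    define w1 where "w1 = deriv w (?h x0)"
    define W2 where "W2 = deriv (deriv w) (?h x0)"
    define d where "d = rx + m * ry"
    have e1: "sx + m * sy = w1 * d"
      using wd(1) gd(1) hd(1) by (simp add: dy y0 p rx_def ry_def sx_def sy_def w1_def d_def)
    have e2: "pdx (pdx \<psi>) p + 2 * m * pdx (pdy \<psi>) p + m\<^sup>2 * pdy (pdy \<psi>) p + q * sy
      = W2 * d\<^sup>2 + w1 * (rxx + 2 * m * rxy + m\<^sup>2 * ryy + q * ry)"
      using wd(2) gd(2) hd unfolding ddy
      by (simp add: dy y0 p rx_def ry_def sx_def sy_def w1_def W2_def rxx_def rxy_def ryy_def d_def)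
    have e3: "W2 = - P0 * w1 - Q0" using w2 by (simp add: w1_def W2_def)
    define N2 where "N2 = pdx (pdx \<psi>) p + 2 * m * pdx (pdy \<psi>) p + m\<^sup>2 * pdy (pdy \<psi>) p"
    define D2 where "D2 = rxx + 2 * m * rxy + m\<^sup>2 * ryy"
    have e2': "N2 + q * sy = (- P0 * w1 - Q0) * d\<^sup>2 + w1 * (D2 + q * ry)"
      using e2 e3 by (simp add: N2_def D2_def)
    have "d * N2 + q * (d * sy - w1 * d * ry) - w1 * d * D2 + P0 * (w1 * d) * d\<^sup>2 + Q0 * d ^ 3
      = d * (N2 + q * sy - ((- P0 * w1 - Q0) * d\<^sup>2 + w1 * (D2 + q * ry)))"
      by (simp add: algebra_simps power2_eq_square power3_eq_cube)
    also have "\<dots> = 0" using e2' by simp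
    finally have "d * N2 + q * (d * sy - (sx + m * sy) * ry) - (sx + m * sy) * D2
        + P0 * (sx + m * sy) * d\<^sup>2 + Q0 * d ^ 3 = 0"
      unfolding e1 by (simp add: mult.assoc)
    then show ?thesis
      unfolding sxx_def sxy_def syy_def d_def N2_def D2_def q_def
      by (simp add: field_simps power2_eq_square power3_eq_cube)
  qed
  have "rx \<noteq> 0 \<or> ry \<noteq> 0" using J0 by auto
  from cubic_coefficients_vanish[OF cubic this]
  show "(rx * sy - ry * sx) * B p = rx * sxx - sx * rxx"
    and "(rx * sy - ry * sx) * A p = ry * sxx - sy * rxx + 2 * (rx * sxy - sx * rxy)"
    and "rx * syy - sx * ryy + 2 * (ry * sxy - sy * rxy) = 0"
    and "ry * syy = sy * ryy" by simp_all
qed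

section \<open>The two projective invariants of a second order equation\<close>

text \<open>The four coefficient identities leave two of the six second derivatives undetermined.  Taking the
  one-form \<open>\<theta>\<close> of the projective change as the two free parameters expresses all six of them in terms of
  first derivatives.  The formulas for \<open>\<theta>\<close> are Cramer's rule for the first and the third pair of these
  expressions.\<close>

lemma second_derivatives_via_projective_change:
  fixes rx ry sx sy :: real
  assumes J: "J = rx * sy - ry * sx" "J \<noteq> 0"
    and c3: "ry * syy = sy * ryy"
    and c2: "rx * syy - sx * ryy + 2 * (ry * sxy - sy * rxy) = 0"
    and c1: "J * A = ry * sxx - sy * rxx + 2 * (rx * sxy - sx * rxy)"
    and c0: "J * B = rx * sxx - sx * rxx"
    and t2: "\<theta>2 = (rx * syy - sx * ryy) / (2 * J)"
    and t1: "\<theta>1 = (sy * (rxx - B * ry) - ry * (sxx - B * sy)) / (2 * J)"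
  shows "rxx = B * ry + 2 * \<theta>1 * rx" "rxy = (A / 2 + \<theta>1) * ry + \<theta>2 * rx" "ryy = 2 * \<theta>2 * ry"
    "sxx = B * sy + 2 * \<theta>1 * sx" "sxy = (A / 2 + \<theta>1) * sy + \<theta>2 * sx" "syy = 2 * \<theta>2 * sy"
proof -
  have t2': "2 * J * \<theta>2 = rx * syy - sx * ryy" using t2 J(2) by simp
  have t1': "2 * J * \<theta>1 = sy * (rxx - B * ry) - ry * (sxx - B * sy)" using t1 J(2) by simp
  have *: "J * a = J * b \<Longrightarrow> a = b" for a b using J(2) by simp
  show "rxx = B * ry + 2 * \<theta>1 * rx" by (rule *) (use J(1) c0 t1' in algebra)
  show "sxx = B * sy + 2 * \<theta>1 * sx" by (rule *) (use J(1) c0 t1' in algebra)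
  show "ryy = 2 * \<theta>2 * ry" by (rule *) (use J(1) c3 t2' in algebra)
  show "syy = 2 * \<theta>2 * sy" by (rule *) (use J(1) c3 t2' in algebra)
  have 2: "2 * J * rxy = J * (A + 2 * \<theta>1) * ry + 2 * J * \<theta>2 * rx"
    using J(1) c0 c1 c2 c3 t1' t2' by algebra
  show "rxy = (A / 2 + \<theta>1) * ry + \<theta>2 * rx" by (rule *) (use 2 in \<open>simp add: algebra_simps\<close>)
  have 2: "2 * J * sxy = J * (A + 2 * \<theta>1) * sy + 2 * J * \<theta>2 * sx"
    using J(1) c0 c1 c2 c3 t1' t2' by algebra
  show "sxy = (A / 2 + \<theta>1) * sy + \<theta>2 * sx" by (rule *) (use 2 in \<open>simp add: algebra_simps\<close>)
qed

text \<open>The equations \<open>r1\<close>, \<open>r2\<close>, \<open>s1\<close>, \<open>s2\<close> are the equalities of the mixed third derivatives of \<open>\<rho>\<close> and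
  \<open>\<psi>\<close>, after the second derivatives have been replaced by their expressions.  The deviations \<open>X\<close>, \<open>Y\<close>, \<open>Z\<close>,
  \<open>W\<close> from the asserted derivatives of \<open>\<theta>\<close> then satisfy two homogeneous linear systems whose determinant
  is the Jacobian.  Here \<open>k = P\<^sub>w / 6\<close> and \<open>\<sigma> = Q\<^sub>w - P\<^sub>z / 2 - P\<^sup>2 / 4\<close> are, up to factors, the components
  of the projective Schouten tensor of the target, and the subtracted terms are its pullback.\<close>

lemma projective_change_integrability:
  fixes rx ry sx sy :: real
  assumes J: "J = rx * sy - ry * sx" "J \<noteq> 0"
    and rxx: "rxx = B * ry + 2 * \<theta>1 * rx" and rxy: "rxy = (A / 2 + \<theta>1) * ry + \<theta>2 * rx"
    and ryy: "ryy = 2 * \<theta>2 * ry"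
    and sxx: "sxx = B * sy + 2 * \<theta>1 * sx - P * rx * sx - Q * rx\<^sup>2"
    and sxy: "sxy = (A / 2 + \<theta>1) * sy + \<theta>2 * sx - P / 2 * (rx * sy + ry * sx) - Q * rx * ry"
    and syy: "syy = 2 * \<theta>2 * sy - P * ry * sy - Q * ry\<^sup>2"
    and Px: "Px = Pz * rx + 6 * k * sx" and Py: "Py = Pz * ry + 6 * k * sy"
    and Qx: "Qx = Qz * rx + (\<sigma> + Pz / 2 + P\<^sup>2 / 4) * sx" and Qy: "Qy = Qz * ry + (\<sigma> + Pz / 2 + P\<^sup>2 / 4) * sy"
    and r1: "2 * (\<theta>2x * ry + \<theta>2 * rxy)
      = (Ay / 2 + \<theta>1y) * ry + (A / 2 + \<theta>1) * ryy + \<theta>2y * rx + \<theta>2 * rxy"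
    and r2: "By * ry + B * ryy + 2 * (\<theta>1y * rx + \<theta>1 * rxy)
      = (Ax / 2 + \<theta>1x) * ry + (A / 2 + \<theta>1) * rxy + \<theta>2x * rx + \<theta>2 * rxx"
    and s1: "2 * (\<theta>2x * sy + \<theta>2 * sxy) - (Px * ry * sy + P * rxy * sy + P * ry * sxy)
        - (Qx * ry\<^sup>2 + Q * 2 * ry * rxy)
      = (Ay / 2 + \<theta>1y) * sy + (A / 2 + \<theta>1) * syy + \<theta>2y * sx + \<theta>2 * sxy
        - (Py / 2 * (rx * sy + ry * sx) + P / 2 * (rxy * sy + rx * syy + ryy * sx + ry * sxy))
        - (Qy * rx * ry + Q * rxy * ry + Q * rx * ryy)"
    and s2: "By * sy + B * syy + 2 * (\<theta>1y * sx + \<theta>1 * sxy)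
        - (Py * rx * sx + P * rxy * sx + P * rx * sxy) - (Qy * rx\<^sup>2 + Q * 2 * rx * rxy)
      = (Ax / 2 + \<theta>1x) * sy + (A / 2 + \<theta>1) * sxy + \<theta>2x * sx + \<theta>2 * sxx
        - (Px / 2 * (rx * sy + ry * sx) + P / 2 * (rxx * sy + rx * sxy + rxy * sx + ry * sxx))
        - (Qx * rx * ry + Q * rxx * ry + Q * rx * rxy)"
  shows "\<theta>2y = \<theta>2\<^sup>2 - (\<sigma> * ry\<^sup>2 + 3 * k * ry * sy)"
    "\<theta>2x = \<theta>2 * (A / 2 + \<theta>1) + Ay / 3 - (\<sigma> * rx * ry + 2 * k * rx * sy + k * ry * sx)"
    "\<theta>1y = \<theta>2 * (A / 2 + \<theta>1) + Ay / 6 - (\<sigma> * rx * ry + k * rx * sy + 2 * k * ry * sx)"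
    "\<theta>1x = \<theta>1\<^sup>2 + \<theta>2 * B + By - Ax / 2 - A\<^sup>2 / 4 - (\<sigma> * rx\<^sup>2 + 3 * k * rx * sx)"
proof -
  have *: "J * a = 0 \<Longrightarrow> a = 0" for a using J(2) by simp
  define X where "X = \<theta>2y - \<theta>2\<^sup>2 + (\<sigma> * ry\<^sup>2 + 3 * k * ry * sy)"
  define Y where "Y = \<theta>2x - \<theta>2 * (A / 2 + \<theta>1) - Ay / 3 + (\<sigma> * rx * ry + 2 * k * rx * sy + k * ry * sx)"
  define Z where "Z = \<theta>1y - \<theta>2 * (A / 2 + \<theta>1) - Ay / 6 + (\<sigma> * rx * ry + k * rx * sy + 2 * k * ry * sx)"
  define W where "W = \<theta>1x - (\<theta>1\<^sup>2 + \<theta>2 * B + By - Ax / 2 - A\<^sup>2 / 4) + (\<sigma> * rx\<^sup>2 + 3 * k * rx * sx)"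
  note defs = X_def Y_def Z_def W_def
  have e1: "rx * X + ry * (Z - 2 * Y) = 0"
    using r1 unfolding defs rxx rxy ryy sxx sxy syy Px Py Qx Qy by (simp add: field_simps power2_eq_square)
  have e2: "sx * X + sy * (Z - 2 * Y) = 0"
    using s1 unfolding defs rxx rxy ryy sxx sxy syy Px Py Qx Qy by (simp add: field_simps power2_eq_square)
  have e3: "rx * (2 * Z - Y) - ry * W = 0"
    using r2 unfolding defs rxx rxy ryy sxx sxy syy Px Py Qx Qy by (simp add: field_simps power2_eq_square)
  have e4: "sx * (2 * Z - Y) - sy * W = 0"
    using s2 unfolding defs rxx rxy ryy sxx sxy syy Px Py Qx Qy by (simp add: field_simps power2_eq_square)
  have 0: "X = 0" by (rule *) (use e1 e2 J(1) in algebra)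
  have 1: "Z - 2 * Y = 0" by (rule *) (use e1 e2 J(1) in algebra)
  have 2: "W = 0" by (rule *) (use e3 e4 J(1) in algebra)
  have 3: "2 * Z - Y = 0" by (rule *) (use e3 e4 J(1) in algebra)
  have "Y = 0" "Z = 0" using 1 3 by auto
  with 0 2 show "\<theta>2y = \<theta>2\<^sup>2 - (\<sigma> * ry\<^sup>2 + 3 * k * ry * sy)"
    "\<theta>2x = \<theta>2 * (A / 2 + \<theta>1) + Ay / 3 - (\<sigma> * rx * ry + 2 * k * rx * sy + k * ry * sx)"
    "\<theta>1y = \<theta>2 * (A / 2 + \<theta>1) + Ay / 6 - (\<sigma> * rx * ry + k * rx * sy + 2 * k * ry * sx)"
    "\<theta>1x = \<theta>1\<^sup>2 + \<theta>2 * B + By - Ax / 2 - A\<^sup>2 / 4 - (\<sigma> * rx\<^sup>2 + 3 * k * rx * sx)"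
    unfolding defs by (simp_all add: algebra_simps)
qed

text \<open>The hypotheses on \<open>k\<close> and \<open>\<sigma>\<close> express that the two invariants of the target vanish: \<open>P\<^sub>w\<close> does not
  depend on \<open>w\<close>, and \<open>\<sigma>\<^sub>w = k\<^sub>z + P k\<close>.  With them everything coming from the target cancels in the
  equalities \<open>c1\<close>, \<open>c2\<close> of the mixed second derivatives of \<open>\<theta>\<close>, and what remains are multiples of the
  invariants of the source.\<close>

lemma invariants_from_projective_change:
  fixes rx ry sx sy :: real
  assumes rxx: "rxx = B * ry + 2 * \<theta>1 * rx" and rxy: "rxy = (A / 2 + \<theta>1) * ry + \<theta>2 * rx"
    and ryy: "ryy = 2 * \<theta>2 * ry"
    and sxx: "sxx = B * sy + 2 * \<theta>1 * sx - P * rx * sx - Q * rx\<^sup>2"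
    and sxy: "sxy = (A / 2 + \<theta>1) * sy + \<theta>2 * sx - P / 2 * (rx * sy + ry * sx) - Q * rx * ry"
    and syy: "syy = 2 * \<theta>2 * sy - P * ry * sy - Q * ry\<^sup>2"
    and kx: "kx = kz * rx" and ky: "ky = kz * ry"
    and \<sigma>x: "\<sigma>x = \<sigma>z * rx + (kz + P * k) * sx" and \<sigma>y: "\<sigma>y = \<sigma>z * ry + (kz + P * k) * sy"
    and t2y: "\<theta>2y = \<theta>2\<^sup>2 - (\<sigma> * ry\<^sup>2 + 3 * k * ry * sy)"
    and t2x: "\<theta>2x = \<theta>2 * (A / 2 + \<theta>1) + Ay / 3 - (\<sigma> * rx * ry + 2 * k * rx * sy + k * ry * sx)"
    and t1y: "\<theta>1y = \<theta>2 * (A / 2 + \<theta>1) + Ay / 6 - (\<sigma> * rx * ry + k * rx * sy + 2 * k * ry * sx)"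
    and t1x: "\<theta>1x = \<theta>1\<^sup>2 + \<theta>2 * B + By - Ax / 2 - A\<^sup>2 / 4 - (\<sigma> * rx\<^sup>2 + 3 * k * rx * sx)"
    and c2: "\<theta>2y * (A / 2 + \<theta>1) + \<theta>2 * (Ay / 2 + \<theta>1y) + Ayy / 3
        - (\<sigma>y * rx * ry + \<sigma> * rxy * ry + \<sigma> * rx * ryy + 2 * (ky * rx * sy + k * rxy * sy + k * rx * syy)
          + (ky * ry * sx + k * ryy * sx + k * ry * sxy))
      = 2 * \<theta>2 * \<theta>2x - (\<sigma>x * ry\<^sup>2 + \<sigma> * 2 * ry * rxy + 3 * (kx * ry * sy + k * rxy * sy + k * ry * sxy))"
    and c1: "2 * \<theta>1 * \<theta>1y + \<theta>2y * B + \<theta>2 * By + Byy - Axy / 2 - A * Ay / 2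
        - (\<sigma>y * rx\<^sup>2 + \<sigma> * 2 * rx * rxy + 3 * (ky * rx * sx + k * rxy * sx + k * rx * sxy))
      = \<theta>2x * (A / 2 + \<theta>1) + \<theta>2 * (Ax / 2 + \<theta>1x) + Axy / 6
        - (\<sigma>x * rx * ry + \<sigma> * rxx * ry + \<sigma> * rx * rxy + (kx * rx * sy + k * rxx * sy + k * rx * sxy)
          + 2 * (kx * ry * sx + k * rxy * sx + k * ry * sxx))"
  shows "Ayy = 0" "3 * Byy - 2 * Axy - 2 * A * Ay = 0"
proof -
  show "Ayy = 0" using c2
    unfolding t1x t1y t2x t2y rxx rxy ryy sxx sxy syy kx ky \<sigma>x \<sigma>y
    by (simp add: field_simps power2_eq_square)
  show "3 * Byy - 2 * Axy - 2 * A * Ay = 0" using c1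
    unfolding t1x t1y t2x t2y rxx rxy ryy sxx sxy syy kx ky \<sigma>x \<sigma>y
    by (simp add: field_simps power2_eq_square)
qed

context plane_domain
begin

text \<open>The functions \<open>P, Q, k, \<sigma>\<close> are pulled back from the target plane, which is why their partial derivatives
  are combinations of those of \<open>\<rho>\<close> and \<open>\<psi>\<close>.\<close>

lemma lie_invariants_vanish:
  fixes \<rho> \<psi> A B P Q k \<sigma> Pz Qz kz \<sigma>z :: "real \<times> real \<Rightarrow> real"
  assumes sm: "sm \<rho>" "sm \<psi>" "sm A" "sm B" "sm P" "sm Q" "sm k" "sm \<sigma>"
    and J: "\<And>p. p \<in> V \<Longrightarrow> pdx \<rho> p * pdy \<psi> p - pdy \<rho> p * pdx \<psi> p \<noteq> 0"
    and P': "\<And>p. p \<in> V \<Longrightarrow> pdx P p = Pz p * pdx \<rho> p + 6 * k p * pdx \<psi> p"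
      "\<And>p. p \<in> V \<Longrightarrow> pdy P p = Pz p * pdy \<rho> p + 6 * k p * pdy \<psi> p"
    and Q': "\<And>p. p \<in> V \<Longrightarrow> pdx Q p = Qz p * pdx \<rho> p + (\<sigma> p + Pz p / 2 + (P p)\<^sup>2 / 4) * pdx \<psi> p"
      "\<And>p. p \<in> V \<Longrightarrow> pdy Q p = Qz p * pdy \<rho> p + (\<sigma> p + Pz p / 2 + (P p)\<^sup>2 / 4) * pdy \<psi> p"
    and k': "\<And>p. p \<in> V \<Longrightarrow> pdx k p = kz p * pdx \<rho> p" "\<And>p. p \<in> V \<Longrightarrow> pdy k p = kz p * pdy \<rho> p"
    and \<sigma>': "\<And>p. p \<in> V \<Longrightarrow> pdx \<sigma> p = \<sigma>z p * pdx \<rho> p + (kz p + P p * k p) * pdx \<psi> p"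
      "\<And>p. p \<in> V \<Longrightarrow> pdy \<sigma> p = \<sigma>z p * pdy \<rho> p + (kz p + P p * k p) * pdy \<psi> p"
  defines "sxx \<equiv> \<lambda>p. pdx (pdx \<psi>) p + P p * pdx \<rho> p * pdx \<psi> p + Q p * (pdx \<rho> p)\<^sup>2"
    and "sxy \<equiv> \<lambda>p. pdx (pdy \<psi>) p + P p / 2 * (pdx \<rho> p * pdy \<psi> p + pdy \<rho> p * pdx \<psi> p)
      + Q p * pdx \<rho> p * pdy \<rho> p"
    and "syy \<equiv> \<lambda>p. pdy (pdy \<psi>) p + P p * pdy \<rho> p * pdy \<psi> p + Q p * (pdy \<rho> p)\<^sup>2"
  assumes c0: "\<And>p. p \<in> V \<Longrightarrow> (pdx \<rho> p * pdy \<psi> p - pdy \<rho> p * pdx \<psi> p) * B p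
      = pdx \<rho> p * sxx p - pdx \<psi> p * pdx (pdx \<rho>) p"
    and c1: "\<And>p. p \<in> V \<Longrightarrow> (pdx \<rho> p * pdy \<psi> p - pdy \<rho> p * pdx \<psi> p) * A p
      = pdy \<rho> p * sxx p - pdy \<psi> p * pdx (pdx \<rho>) p
        + 2 * (pdx \<rho> p * sxy p - pdx \<psi> p * pdx (pdy \<rho>) p)"
    and c2: "\<And>p. p \<in> V \<Longrightarrow> pdx \<rho> p * syy p - pdx \<psi> p * pdy (pdy \<rho>) p
      + 2 * (pdy \<rho> p * sxy p - pdy \<psi> p * pdx (pdy \<rho>) p) = 0"
    and c3: "\<And>p. p \<in> V \<Longrightarrow> pdy \<rho> p * syy p = pdy \<psi> p * pdy (pdy \<rho>) p"
    and p: "p \<in> V"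
  shows "pdy (pdy A) p = 0" "3 * pdy (pdy B) p - 2 * pdx (pdy A) p - 2 * A p * pdy A p = 0"
proof -
  define \<theta>1 where "\<theta>1 = (\<lambda>p. (pdy \<psi> p * (pdx (pdx \<rho>) p - B p * pdy \<rho> p) - pdy \<rho> p * (sxx p - B p * pdy \<psi> p))
    / (2 * (pdx \<rho> p * pdy \<psi> p - pdy \<rho> p * pdx \<psi> p)))"
  define \<theta>2 where "\<theta>2 = (\<lambda>p. (pdx \<rho> p * syy p - pdx \<psi> p * pdy (pdy \<rho>) p)
    / (2 * (pdx \<rho> p * pdy \<psi> p - pdy \<rho> p * pdx \<psi> p)))"
  have sm\<theta>: "sm \<theta>1" "sm \<theta>2"
    unfolding \<theta>1_def \<theta>2_def sxx_def syy_def using sm J by (auto intro!: sm_intros)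
  note smo = sm sm\<theta>
  note rules = pd_rules sm_intros smo
  have eqsB: "\<forall>p\<in>V. pdx (pdx \<rho>) p = B p * pdy \<rho> p + 2 * \<theta>1 p * pdx \<rho> p"
    "\<forall>p\<in>V. pdx (pdy \<rho>) p = (A p / 2 + \<theta>1 p) * pdy \<rho> p + \<theta>2 p * pdx \<rho> p"
    "\<forall>p\<in>V. pdy (pdy \<rho>) p = 2 * \<theta>2 p * pdy \<rho> p"
    "\<forall>p\<in>V. pdx (pdx \<psi>) p = B p * pdy \<psi> p + 2 * \<theta>1 p * pdx \<psi> p - P p * pdx \<rho> p * pdx \<psi> p - Q p * (pdx \<rho> p)\<^sup>2"
    "\<forall>p\<in>V. pdx (pdy \<psi>) p = (A p / 2 + \<theta>1 p) * pdy \<psi> p + \<theta>2 p * pdx \<psi> p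
      - P p / 2 * (pdx \<rho> p * pdy \<psi> p + pdy \<rho> p * pdx \<psi> p) - Q p * pdx \<rho> p * pdy \<rho> p"
    "\<forall>p\<in>V. pdy (pdy \<psi>) p = 2 * \<theta>2 p * pdy \<psi> p - P p * pdy \<rho> p * pdy \<psi> p - Q p * (pdy \<rho> p)\<^sup>2"
    using second_derivatives_via_projective_change[OF refl J c3 c2 c1 c0 fun_cong[OF \<theta>2_def] fun_cong[OF \<theta>1_def]]
    by (auto simp: sxx_def sxy_def syy_def algebra_simps)
  note eqs = eqsB[THEN bspec]
  have swap: "pdy (pdx f) p = pdx (pdy f) p" if "sm f" "p \<in> V" for f p
    using mixed_partials_commute[OF open_V that] .
  have yxB: "\<forall>p\<in>V. pdy (pdx \<rho>) p = pdx (pdy \<rho>) p" "\<forall>p\<in>V. pdy (pdx \<psi>) p = pdx (pdy \<psi>) p"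
    using swap sm(1,2) by blast+
  note yx = yxB[THEN bspec]
  have d\<theta>: "pdy \<theta>2 p = (\<theta>2 p)\<^sup>2 - (\<sigma> p * (pdy \<rho> p)\<^sup>2 + 3 * k p * pdy \<rho> p * pdy \<psi> p)"
    "pdx \<theta>2 p = \<theta>2 p * (A p / 2 + \<theta>1 p) + pdy A p / 3
      - (\<sigma> p * pdx \<rho> p * pdy \<rho> p + 2 * k p * pdx \<rho> p * pdy \<psi> p + k p * pdy \<rho> p * pdx \<psi> p)"
    "pdy \<theta>1 p = \<theta>2 p * (A p / 2 + \<theta>1 p) + pdy A p / 6
      - (\<sigma> p * pdx \<rho> p * pdy \<rho> p + k p * pdx \<rho> p * pdy \<psi> p + 2 * k p * pdy \<rho> p * pdx \<psi> p)"
    "pdx \<theta>1 p = (\<theta>1 p)\<^sup>2 + \<theta>2 p * B p + pdy B p - pdx A p / 2 - (A p)\<^sup>2 / 4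
      - (\<sigma> p * (pdx \<rho> p)\<^sup>2 + 3 * k p * pdx \<rho> p * pdx \<psi> p)"
    if p: "p \<in> V" for p
  proof -
    have "pdx (pdy (pdy \<rho>)) p = pdy (pdx (pdy \<rho>)) p" "pdy (pdx (pdx \<rho>)) p = pdx (pdx (pdy \<rho>)) p"
      "pdx (pdy (pdy \<psi>)) p = pdy (pdx (pdy \<psi>)) p" "pdy (pdx (pdx \<psi>)) p = pdx (pdx (pdy \<psi>)) p"
      using p sm swap pd_cong[OF open_V p, of "pdy (pdx \<rho>)", OF yxB(1)] pd_cong[OF open_V p, of "pdy (pdx \<psi>)", OF yxB(2)] by (simp_all add: sm_intros)
    note raw = this[unfolded pd_cong[OF open_V p, of "pdx (pdx \<rho>)", OF eqsB(1)] pd_cong[OF open_V p, of "pdx (pdy \<rho>)", OF eqsB(2)]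
      pd_cong[OF open_V p, of "pdy (pdy \<rho>)", OF eqsB(3)] pd_cong[OF open_V p, of "pdx (pdx \<psi>)", OF eqsB(4)] pd_cong[OF open_V p, of "pdx (pdy \<psi>)", OF eqsB(5)]
      pd_cong[OF open_V p, of "pdy (pdy \<psi>)", OF eqsB(6)]]
    note xy = yx[OF p]
    show "pdy \<theta>2 p = (\<theta>2 p)\<^sup>2 - (\<sigma> p * (pdy \<rho> p)\<^sup>2 + 3 * k p * pdy \<rho> p * pdy \<psi> p)"
    "pdx \<theta>2 p = \<theta>2 p * (A p / 2 + \<theta>1 p) + pdy A p / 3
      - (\<sigma> p * pdx \<rho> p * pdy \<rho> p + 2 * k p * pdx \<rho> p * pdy \<psi> p + k p * pdy \<rho> p * pdx \<psi> p)"
    "pdy \<theta>1 p = \<theta>2 p * (A p / 2 + \<theta>1 p) + pdy A p / 6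
      - (\<sigma> p * pdx \<rho> p * pdy \<rho> p + k p * pdx \<rho> p * pdy \<psi> p + 2 * k p * pdy \<rho> p * pdx \<psi> p)"
    "pdx \<theta>1 p = (\<theta>1 p)\<^sup>2 + \<theta>2 p * B p + pdy B p - pdx A p / 2 - (A p)\<^sup>2 / 4
      - (\<sigma> p * (pdx \<rho> p)\<^sup>2 + 3 * k p * pdx \<rho> p * pdx \<psi> p)"
      by (rule projective_change_integrability[OF refl J[OF p] eqs[OF p] P'[OF p] Q'[OF p], of "pdx \<theta>2 p" "pdy A p" "pdy \<theta>1 p" "pdy \<theta>2 p"
          "pdy B p" "pdx A p" "pdx \<theta>1 p"];
        use raw in \<open>simp add: rules p xy algebra_simps add_divide_distrib diff_divide_distrib\<close>)+
  qed
  have d\<theta>B: "\<forall>p\<in>V. pdy \<theta>2 p = (\<theta>2 p)\<^sup>2 - (\<sigma> p * (pdy \<rho> p)\<^sup>2 + 3 * k p * pdy \<rho> p * pdy \<psi> p)"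
    "\<forall>p\<in>V. pdx \<theta>2 p = \<theta>2 p * (A p / 2 + \<theta>1 p) + pdy A p / 3
      - (\<sigma> p * pdx \<rho> p * pdy \<rho> p + 2 * k p * pdx \<rho> p * pdy \<psi> p + k p * pdy \<rho> p * pdx \<psi> p)"
    "\<forall>p\<in>V. pdy \<theta>1 p = \<theta>2 p * (A p / 2 + \<theta>1 p) + pdy A p / 6
      - (\<sigma> p * pdx \<rho> p * pdy \<rho> p + k p * pdx \<rho> p * pdy \<psi> p + 2 * k p * pdy \<rho> p * pdx \<psi> p)"
    "\<forall>p\<in>V. pdx \<theta>1 p = (\<theta>1 p)\<^sup>2 + \<theta>2 p * B p + pdy B p - pdx A p / 2 - (A p)\<^sup>2 / 4
      - (\<sigma> p * (pdx \<rho> p)\<^sup>2 + 3 * k p * pdx \<rho> p * pdx \<psi> p)"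
    using d\<theta> by blast+
  have "pdy (pdx \<theta>2) p = pdx (pdy \<theta>2) p" "pdy (pdx \<theta>1) p = pdx (pdy \<theta>1) p"
    using p swap sm\<theta> by blast+
  note raw = this[unfolded pd_cong[OF open_V p, of "pdy \<theta>2", OF d\<theta>B(1)] pd_cong[OF open_V p, of "pdx \<theta>2", OF d\<theta>B(2)]
    pd_cong[OF open_V p, of "pdy \<theta>1", OF d\<theta>B(3)] pd_cong[OF open_V p, of "pdx \<theta>1", OF d\<theta>B(4)]]
  note xy = yx[OF p] swap[OF sm(3) p]
  show "pdy (pdy A) p = 0" "3 * pdy (pdy B) p - 2 * pdx (pdy A) p - 2 * A p * pdy A p = 0"
    by (rule invariants_from_projective_change[OF eqs[OF p] k'[OF p] \<sigma>'[OF p] d\<theta>[OF p], of "pdy (pdy A) p" "pdy (pdy B) p" "pdx (pdy A) p"];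
      use raw in \<open>simp add: rules p xy algebra_simps add_divide_distrib diff_divide_distrib\<close>)+
qed

end

section \<open>The second equation of the chain along a curve\<close>

text \<open>The first two conclusions give \<open>y'\<close> and \<open>\<eta>'\<close> in terms of \<open>y\<close>, \<open>\<eta> = \<Omega>\<^sub>F[y]\<close> and \<open>\<theta> = \<Omega>\<^sub>F\<^sup>2[y]\<close>.  In these
  variables the slopes of transformed curves can be differentiated without the appearance of \<open>y''\<close>.\<close>

lemma Omega_iterates:
  assumes U: "open U" and F: "smooth_on U F" and I: "open I" and y: "Ck_on 2 I y"
    and graph: "\<forall>x\<in>I. (x, y x) \<in> U" and x: "x \<in> I"
  defines "\<eta> \<equiv> Omega F y y" and "\<theta> \<equiv> Omega F y (Omega F y y)"
  shows "(y has_real_derivative \<eta> x - F (x, y x) * y x) (at x)"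
    and "(\<eta> has_real_derivative \<theta> x - F (x, y x) * \<eta> x) (at x)"
    and "riccati_abel_chain F 2 y x \<longleftrightarrow> \<theta> x = 0"
    and "\<theta> x = deriv (deriv y) x + (2 * F (x, y x) + y x * pdy F (x, y x)) * deriv y x
           + y x * ((F (x, y x))\<^sup>2 + pdx F (x, y x))"
proof -
  note y' = Ck_on_2_D[OF I y x]
  show "(y has_real_derivative \<eta> x - F (x, y x) * y x) (at x)"
    using y'(1) by (simp add: \<eta>_def Omega_def)
  have d: "(\<eta> has_real_derivative (deriv (deriv y) x
      + ((pdx F (x, y x) + deriv y x * pdy F (x, y x)) * y x + deriv y x * F (x, y x)))) (at x)"
    unfolding \<eta>_def Omega_def
    by (intro DERIV_add DERIV_mult smooth_on_along_curve[OF F bspec[OF graph]] y' x)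
  have \<theta>: "\<theta> x = deriv \<eta> x + F (x, y x) * \<eta> x" by (simp add: \<theta>_def \<eta>_def Omega_def)
  show "(\<eta> has_real_derivative \<theta> x - F (x, y x) * \<eta> x) (at x)"
    using d DERIV_imp_deriv[OF d] \<theta> by simp
  show "riccati_abel_chain F 2 y x \<longleftrightarrow> \<theta> x = 0"
    by (simp add: riccati_abel_chain_def \<theta>_def numeral_2_eq_2)
  show "\<theta> x = deriv (deriv y) x + (2 * F (x, y x) + y x * pdy F (x, y x)) * deriv y x
           + y x * ((F (x, y x))\<^sup>2 + pdx F (x, y x))"
    unfolding \<theta> DERIV_imp_deriv[OF d]
    by (simp add: \<eta>_def Omega_def algebra_simps power2_eq_square)
qed

lemma smooth_on_linear_coefficient:
  assumes "open I" "smooth_on I \<alpha>"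
  shows "open (I \<times> (UNIV :: real set))" "smooth_on (I \<times> UNIV) (\<lambda>(x, y). \<alpha> x * y)"
    and "\<And>x y. x \<in> I \<Longrightarrow> pdx (\<lambda>(x, y). \<alpha> x * y) (x, y) = deriv \<alpha> x * y"
    and "\<And>x y. pdy (\<lambda>(x, y). \<alpha> x * y) (x, y) = \<alpha> x"
proof -
  show op: "open (I \<times> (UNIV :: real set))" using assms(1) by (intro open_Times open_UNIV)
  have "smooth_on (I \<times> UNIV) (\<lambda>q. \<alpha> (fst q) * snd q)"
    by (rule smooth_on_mult[OF op smooth_on_compose[OF op assms(1) _ assms(2) smooth_on_fst[OF op]]
          smooth_on_snd[OF op]]) auto
  then show "smooth_on (I \<times> UNIV) (\<lambda>(x, y). \<alpha> x * y)" by (simp add: case_prod_unfold)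
  show "pdx (\<lambda>(x, y). \<alpha> x * y) (x, y) = deriv \<alpha> x * y" if "x \<in> I" for x y
    using smooth_on_has_deriv[OF assms(2) that] unfolding pdx_def
    by (auto intro!: DERIV_imp_deriv derivative_eq_intros)
  show "pdy (\<lambda>(x, y). \<alpha> x * y) (x, y) = \<alpha> x" for x y
    unfolding pdy_def by (auto intro!: DERIV_imp_deriv derivative_eq_intros)
qed

lemma chain_linear_coefficient:
  assumes I: "open I" "smooth_on I \<alpha>" and I': "open I'" "I' \<subseteq> I" and y: "Ck_on 2 I' y" and x: "x \<in> I'"
  shows "riccati_abel_chain (\<lambda>(x, y). \<alpha> x * y) 2 y x \<longleftrightarrow>
    deriv (deriv y) x + 3 * \<alpha> x * y x * deriv y x + deriv \<alpha> x * (y x)\<^sup>2 + (\<alpha> x)\<^sup>2 * (y x) ^ 3 = 0"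
proof -
  note l = smooth_on_linear_coefficient[OF I]
  have "x \<in> I" using x I'(2) by auto
  moreover have "\<forall>x\<in>I'. (x, y x) \<in> I \<times> UNIV" using I'(2) by auto
  ultimately show ?thesis
    using Omega_iterates(3,4)[OF l(1,2) I'(1) y _ x] l(3)[of x "y x"] l(4)[of x "y x"]
    by (simp add: algebra_simps power2_eq_square power3_eq_cube)
qed

section \<open>Linearizable equations have an affine coefficient\<close>

context plane_domain
begin

text \<open>Put \<open>G = F\<^sub>y\<^sub>y\<close> and \<open>H = F - y F\<^sub>y\<close>.  The two invariants are \<open>4 G + y G\<^sub>y\<close> and
  \<open>y (G\<^sub>x + 2 G H)\<close>.  Where \<open>y = 0\<close> the first one is \<open>4 G\<close>.  Elsewhere, differentiating the first in \<open>x\<close> and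
  the second in \<open>y\<close> and eliminating \<open>G\<^sub>x\<close>, \<open>G\<^sub>y\<close>, \<open>G\<^sub>x\<^sub>y\<close> leaves \<open>2 y\<^sup>2 G\<^sup>2 = 0\<close>.  The first invariant alone
  would admit an additional term \<open>\<gamma>(x) / y\<^sup>2\<close> in \<open>F\<close>.\<close>

lemma second_derivative_vanishes:
  fixes F :: "real \<times> real \<Rightarrow> real"
  assumes F: "sm F"
  defines "A \<equiv> \<lambda>q. 2 * F q + snd q * pdy F q" and "B \<equiv> \<lambda>q. snd q * ((F q)\<^sup>2 + pdx F q)"
  assumes A: "\<And>p. p \<in> V \<Longrightarrow> pdy (pdy A) p = 0"
    and B: "\<And>p. p \<in> V \<Longrightarrow> 3 * pdy (pdy B) p - 2 * pdx (pdy A) p - 2 * A p * pdy A p = 0"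
    and p: "p \<in> V"
  shows "pdy (pdy F) p = 0"
proof -
  define G where "G = pdy (pdy F)"
  define H where "H = (\<lambda>q. F q - snd q * pdy F q)"
  have smG: "sm G" "sm H" unfolding G_def H_def by (intro sm_intros F)+
  note rules = pd_rules sm_intros F smG
  have swap: "pdy (pdx f) q = pdx (pdy f) q" if "sm f" "q \<in> V" for f q
    using mixed_partials_commute[OF open_V that] .
  have Ay: "\<forall>q\<in>V. pdy A q = 3 * pdy F q + snd q * G q"
    by (simp add: A_def rules G_def)
  have "pdy (pdy A) q = 4 * G q + snd q * pdy G q" if "q \<in> V" for q
    using that pd_cong(2)[OF open_V that Ay] by (simp add: rules G_def)
  then have 1: "\<forall>q\<in>V. 4 * G q + snd q * pdy G q = 0" using A by simp
  have yx: "\<forall>q\<in>V. pdy (pdx F) q = pdx (pdy F) q" using swap F by blast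
  have By: "\<forall>q\<in>V. pdy B q = (F q)\<^sup>2 + pdx F q + snd q * (2 * F q * pdy F q + pdx (pdy F) q)"
    using yx by (simp add: B_def rules)
  have 2: "\<forall>q\<in>V. snd q * (pdx G q + 2 * G q * H q) = 0"
  proof
    fix q assume q: "q \<in> V"
    have "pdy (pdy B) q = 2 * (2 * F q * pdy F q + pdx (pdy F) q)
        + snd q * (2 * (pdy F q)\<^sup>2 + 2 * F q * G q + pdx G q)"
      using q yx pd_cong(2)[OF open_V q By] swap[of "pdy F" q]
      by (simp add: rules G_def algebra_simps power2_eq_square)
    moreover have "pdx (pdy A) q = 3 * pdx (pdy F) q + snd q * pdx G q"
      using q pd_cong(1)[OF open_V q Ay] by (simp add: rules)
    moreover have "pdy A q = 3 * pdy F q + snd q * G q" using Ay q by blast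
    ultimately show "snd q * (pdx G q + 2 * G q * H q) = 0"
      using B[OF q] by (simp add: A_def H_def algebra_simps power2_eq_square)
  qed
  have Hy: "pdy H p = - snd p * G p" using p by (simp add: H_def G_def rules)
  have "pdy (\<lambda>q. snd q * (pdx G q + 2 * G q * H q)) p = 0"
    using pd_cong(2)[OF open_V p 2] by (simp add: pd_const)
  then have 3: "pdx G p + 2 * G p * H p
      + snd p * (pdx (pdy G) p + 2 * pdy G p * H p + 2 * G p * (- snd p * G p)) = 0"
    using p Hy swap[OF smG(1)] by (simp add: rules algebra_simps)
  have "pdx (\<lambda>q. 4 * G q + snd q * pdy G q) p = 0"
    using pd_cong(1)[OF open_V p 1] by (simp add: pd_const)
  then have 4: "4 * pdx G p + snd p * pdx (pdy G) p = 0"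
    using p by (simp add: rules)
  show ?thesis
  proof (cases "snd p = 0")
    case True
    then show ?thesis using 1[rule_format, OF p] by (simp add: G_def)
  next
    case False
    then have "pdx G p + 2 * G p * H p = 0" using 2 p by auto
    moreover have "4 * G p + snd p * pdy G p = 0" using 1 p by blast
    moreover have "2 * (snd p)\<^sup>2 * (G p)\<^sup>2 = - 3 * (pdx G p + 2 * G p * H p)
        + (4 * pdx G p + snd p * pdx (pdy G) p) + 2 * H p * (4 * G p + snd p * pdy G p)
        - (pdx G p + 2 * G p * H p
      + snd p * (pdx (pdy G) p + 2 * pdy G p * H p + 2 * G p * (- snd p * G p)))"
      by (simp add: algebra_simps power2_eq_square)
    ultimately have "2 * (snd p)\<^sup>2 * (G p)\<^sup>2 = 0" unfolding 3 4 by simp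
    then show ?thesis using False by (simp add: G_def)
  qed
qed

end

lemma affine_if_second_derivative_vanishes:
  fixes F :: "real \<times> real \<Rightarrow> real"
  assumes V: "open V" and F: "smooth_on V F" and F2: "\<And>p. p \<in> V \<Longrightarrow> pdy (pdy F) p = 0" and p: "p \<in> V"
  shows "\<exists>W \<alpha> \<beta>. open W \<and> p \<in> W \<and> smooth_on (fst ` W) \<alpha> \<and> smooth_on (fst ` W) \<beta> \<and>
    (\<forall>(x, y)\<in>W. F (x, y) = \<alpha> x * y + \<beta> x)"
proof -
  obtain x0 y0 where p0: "p = (x0, y0)" by fastforce
  obtain X Y where XY: "open X" "open Y" "x0 \<in> X" "y0 \<in> Y" "X \<times> Y \<subseteq> V"
    using V p p0 by (metis open_prod_elim mem_Sigma_iff)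
  obtain e where e: "e > 0" "ball y0 e \<subseteq> Y" using XY openE by blast
  have sub: "X \<times> ball y0 e \<subseteq> V" using e XY by auto
  define \<alpha> where "\<alpha> = (\<lambda>x. pdy F (x, y0))"
  define \<beta> where "\<beta> = (\<lambda>x. F (x, y0) - \<alpha> x * y0)"
  have slice: "smooth_on X (\<lambda>x. f (x, y0))" if "smooth_on V f" for f :: "real \<times> real \<Rightarrow> real"
    unfolding smooth_on_def
    using Ck_on_along_curve[OF XY(1) that Ck_on_const[OF XY(1)] _ V] XY(4,5) by blast
  have sm: "smooth_on X \<alpha>" "smooth_on X \<beta>"
    unfolding \<beta>_def unfolding \<alpha>_def by (intro smooth_intros slice F smooth_on_pdy V XY(1))+
  have "F (x, y) = \<alpha> x * y + \<beta> x" if xy: "x \<in> X" "y \<in> ball y0 e" for x y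
  proof -
    have in_V: "(x, t) \<in> V" if "t \<in> ball y0 e" for t using sub xy that by auto
    have y0: "y0 \<in> ball y0 e" using e(1) by simp
    have c1: "pdy F (x, t) = \<alpha> x" if "t \<in> ball y0 e" for t
    proof -
      have "\<exists>c. \<forall>t\<in>ball y0 e. pdy F (x, t) = c"
        by (rule has_field_derivative_zero_constant)
          (use has_real_derivative_pdy[OF smooth_on_pdy[OF V F] in_V] F2[OF in_V] in
            \<open>auto intro: has_field_derivative_at_within\<close>)
      then show ?thesis using that y0 unfolding \<alpha>_def by metis
    qed
    have "\<exists>c. \<forall>t\<in>ball y0 e. F (x, t) - \<alpha> x * t = c"
    proof (rule has_field_derivative_zero_constant)
      fix t assume t: "t \<in> ball y0 e"
      have "((\<lambda>t. F (x, t) - \<alpha> x * t) has_real_derivative pdy F (x, t) - \<alpha> x) (at t)"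
        using has_real_derivative_pdy[OF F in_V[OF t]] by (auto intro!: derivative_eq_intros)
      then show "((\<lambda>t. F (x, t) - \<alpha> x * t) has_field_derivative 0) (at t within ball y0 e)"
        using c1[OF t] by (auto intro: has_field_derivative_at_within)
    qed simp
    then have "F (x, y) - \<alpha> x * y = F (x, y0) - \<alpha> x * y0" using xy(2) y0 by metis
    then show ?thesis by (simp add: \<beta>_def)
  qed
  moreover have "fst ` (X \<times> ball y0 e) = X" using e(1) by force
  moreover have "open (X \<times> ball y0 e)" using XY(1) by (intro open_Times open_ball)
  moreover have "p \<in> X \<times> ball y0 e" using p0 XY e(1) by simp
  ultimately show ?thesis using sm
    by (intro exI[of _ "X \<times> ball y0 e"] exI[of _ \<alpha>] exI[of _ \<beta>]) auto
qed

lemma maps_ode_subset: "maps_ode V \<rho> \<psi> E E' \<Longrightarrow> W \<subseteq> V \<Longrightarrow> maps_ode W \<rho> \<psi> E E'"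
  unfolding maps_ode_def by blast

lemma point_transformation_subset:
  "point_transformation V \<rho> \<psi> \<Longrightarrow> open W \<Longrightarrow> W \<subseteq> V \<Longrightarrow> point_transformation W \<rho> \<psi>"
  unfolding point_transformation_def using smooth_on_subset by blast

text \<open>The target \<open>w'' + P w' + Q = 0\<close> is the most general one of its kind for which both invariants vanish:
  the first makes \<open>P\<close> affine in \<open>w\<close>, and the second then fixes the quadratic and the cubic part of \<open>Q\<close>.  It
  comprises the linear equations (\<open>\<alpha> = 0\<close>) and the equations of the chain with coefficient \<open>\<alpha>(z) w\<close>
  (\<open>a = q0 = q1 = 0\<close>).\<close>

lemma affine_if_mapped_to_linearizable_form:
  fixes F :: "real \<times> real \<Rightarrow> real" and a \<alpha> q0 q1 :: "real \<Rightarrow> real"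
  assumes U: "open U" and F: "smooth_on U F" and pU: "p \<in> U" and pV: "p \<in> V"
    and pt: "point_transformation V \<rho> \<psi>" and K: "open K" "\<rho> ` V \<subseteq> K"
    and sm: "smooth_on K a" "smooth_on K \<alpha>" "smooth_on K q0" "smooth_on K q1"
    and maps: "maps_ode V \<rho> \<psi> (riccati_abel_chain F 2) E'"
    and E': "\<And>J w z. open J \<Longrightarrow> Ck_on 2 J w \<Longrightarrow> J \<subseteq> K \<Longrightarrow> z \<in> J \<Longrightarrow> E' w z \<longleftrightarrow>
      deriv (deriv w) z + (a z + 3 * \<alpha> z * w z) * deriv w z
      + (q0 z + q1 z * w z + (deriv \<alpha> z + a z * \<alpha> z) * (w z)\<^sup>2 + (\<alpha> z)\<^sup>2 * (w z) ^ 3) = 0"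
  shows "\<exists>W \<alpha> \<beta>. open W \<and> p \<in> W \<and> smooth_on (fst ` W) \<alpha> \<and> smooth_on (fst ` W) \<beta> \<and>
    (\<forall>(x, y)\<in>W. F (x, y) = \<alpha> x * y + \<beta> x)"
proof -
  define W where "W = U \<inter> V"
  have W: "open W" "p \<in> W" "W \<subseteq> U" "W \<subseteq> V"
    using U pU pV pt by (auto simp: W_def point_transformation_def)
  interpret plane_domain W by unfold_locales (rule W(1))
  note ptW = point_transformation_subset[OF pt W(1,4)]
  note mapsW = maps_ode_subset[OF maps W(4)]
  have smF: "sm F" using F W(3) by (rule smooth_on_subset)
  have smr: "sm \<rho>" "sm \<psi>" and J: "\<And>p. p \<in> W \<Longrightarrow> pdx \<rho> p * pdy \<psi> p - pdy \<rho> p * pdx \<psi> p \<noteq> 0"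
    using ptW by (auto simp: point_transformation_def)
  have rK: "\<rho> ` W \<subseteq> K" using K(2) W(4) by auto
  have comp: "sm (\<lambda>q. f (\<rho> q))" if "smooth_on K f" for f :: "real \<Rightarrow> real"
    by (rule smooth_on_compose[OF W(1) K(1) rK that smr(1)])
  have dcomp: "pdx (\<lambda>q. f (\<rho> q)) q = deriv f (\<rho> q) * pdx \<rho> q" "pdy (\<lambda>q. f (\<rho> q)) q = deriv f (\<rho> q) * pdy \<rho> q"
    if "smooth_on K f" "q \<in> W" for f :: "real \<Rightarrow> real" and q
    using pd_compose[OF smr(1) that(2)] smooth_on_differentiable[OF that(1)] rK that(2) by blast+
  note sm' = sm smooth_on_deriv[OF K(1) sm(1)] smooth_on_deriv[OF K(1) sm(2)]
  define A where "A = (\<lambda>q. 2 * F q + snd q * pdy F q)"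
  define B where "B = (\<lambda>q. snd q * ((F q)\<^sup>2 + pdx F q))"
  define P where "P = (\<lambda>(z, w). a z + 3 * \<alpha> z * w)"
  define Q where "Q = (\<lambda>(z, w). q0 z + q1 z * w + (deriv \<alpha> z + a z * \<alpha> z) * w\<^sup>2 + (\<alpha> z)\<^sup>2 * w ^ 3)"
  have E: "riccati_abel_chain F 2 y x \<longleftrightarrow> deriv (deriv y) x + A (x, y x) * deriv y x + B (x, y x) = 0"
    if "open I" "Ck_on 2 I y" "\<And>x. x \<in> I \<Longrightarrow> (x, y x) \<in> W" "x \<in> I" for I y x
    using Omega_iterates(3,4)[OF W(1) smF that(1,2) _ that(4)] that(3) by (simp add: A_def B_def)
  have E'': "E' w z \<longleftrightarrow> deriv (deriv w) z + P (z, w z) * deriv w z + Q (z, w z) = 0"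
    if "open J" "Ck_on 2 J w" "J \<subseteq> \<rho> ` W" "z \<in> J" for J w z
    using E'[OF that(1,2) _ that(4)] that(3) rK by (simp add: P_def Q_def)
  note coeffs = maps_ode_coefficients[OF ptW mapsW E E'']
  \<comment> \<open>The pullbacks of \<open>P\<close>, \<open>Q\<close>, of \<open>k = P\<^sub>w / 6\<close> and \<open>\<sigma> = Q\<^sub>w - P\<^sub>z / 2 - P\<^sup>2 / 4\<close>, and of the partial derivatives with
      respect to \<open>z\<close> that enter the chain rule.\<close>
  define P' where "P' = (\<lambda>q. a (\<rho> q) + 3 * \<alpha> (\<rho> q) * \<psi> q)"
  define Q' where "Q' = (\<lambda>q. q0 (\<rho> q) + q1 (\<rho> q) * \<psi> q + (deriv \<alpha> (\<rho> q) + a (\<rho> q) * \<alpha> (\<rho> q)) * (\<psi> q)\<^sup>2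
    + (\<alpha> (\<rho> q))\<^sup>2 * (\<psi> q * (\<psi> q)\<^sup>2))"
  define Pz where "Pz = (\<lambda>q. deriv a (\<rho> q) + 3 * deriv \<alpha> (\<rho> q) * \<psi> q)"
  define k where "k = (\<lambda>q. \<alpha> (\<rho> q) / 2)"
  define kz where "kz = (\<lambda>q. deriv \<alpha> (\<rho> q) / 2)"
  define \<sigma> where "\<sigma> = (\<lambda>q. q1 (\<rho> q) + 2 * (deriv \<alpha> (\<rho> q) + a (\<rho> q) * \<alpha> (\<rho> q)) * \<psi> q
    + 3 * (\<alpha> (\<rho> q))\<^sup>2 * (\<psi> q)\<^sup>2 - (deriv a (\<rho> q) + 3 * deriv \<alpha> (\<rho> q) * \<psi> q) / 2
    - (a (\<rho> q) + 3 * \<alpha> (\<rho> q) * \<psi> q)\<^sup>2 / 4)"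
  define Qz where "Qz = (\<lambda>q. deriv q0 (\<rho> q) + deriv q1 (\<rho> q) * \<psi> q
    + (deriv (deriv \<alpha>) (\<rho> q) + deriv a (\<rho> q) * \<alpha> (\<rho> q) + a (\<rho> q) * deriv \<alpha> (\<rho> q)) * (\<psi> q)\<^sup>2
    + 2 * \<alpha> (\<rho> q) * deriv \<alpha> (\<rho> q) * (\<psi> q * (\<psi> q)\<^sup>2))"
  define \<sigma>z where "\<sigma>z = (\<lambda>q. deriv q1 (\<rho> q)
    + 2 * (deriv (deriv \<alpha>) (\<rho> q) + deriv a (\<rho> q) * \<alpha> (\<rho> q) + a (\<rho> q) * deriv \<alpha> (\<rho> q)) * \<psi> q
    + 6 * \<alpha> (\<rho> q) * deriv \<alpha> (\<rho> q) * (\<psi> q)\<^sup>2 - (deriv (deriv a) (\<rho> q) + 3 * deriv (deriv \<alpha>) (\<rho> q) * \<psi> q) / 2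
    - (a (\<rho> q) + 3 * \<alpha> (\<rho> q) * \<psi> q) * (deriv a (\<rho> q) + 3 * deriv \<alpha> (\<rho> q) * \<psi> q) / 2)"
  note comps = comp[OF sm(1)] comp[OF sm(2)] comp[OF sm(3)] comp[OF sm(4)] comp[OF sm'(5)] comp[OF sm'(6)]
  have smP: "sm A" "sm B" "sm P'" "sm Q'" "sm k" "sm \<sigma>"
    unfolding A_def B_def P'_def Q'_def k_def \<sigma>_def
    by (auto intro!: sm_intros smF smr comps)
  note rules = pd_rules sm_intros smr comps dcomp[OF sm(1)] dcomp[OF sm(2)] dcomp[OF sm(3)] dcomp[OF sm(4)]
     dcomp[OF sm'(5)] dcomp[OF sm'(6)]
  have dP: "pdx P' q = Pz q * pdx \<rho> q + 6 * k q * pdx \<psi> q" "pdy P' q = Pz q * pdy \<rho> q + 6 * k q * pdy \<psi> q"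
    if "q \<in> W" for q
    using that by (simp_all add: P'_def Pz_def k_def rules algebra_simps)
  have dQ: "pdx Q' q = Qz q * pdx \<rho> q + (\<sigma> q + Pz q / 2 + (P' q)\<^sup>2 / 4) * pdx \<psi> q"
    "pdy Q' q = Qz q * pdy \<rho> q + (\<sigma> q + Pz q / 2 + (P' q)\<^sup>2 / 4) * pdy \<psi> q"
    if "q \<in> W" for q
    using that by (simp_all add: P'_def Pz_def Q'_def Qz_def \<sigma>_def rules field_simps power2_eq_square)
  have dk: "pdx k q = kz q * pdx \<rho> q" "pdy k q = kz q * pdy \<rho> q" if "q \<in> W" for q
    using that by (simp_all add: k_def kz_def rules)
  have d\<sigma>: "pdx \<sigma> q = \<sigma>z q * pdx \<rho> q + (kz q + P' q * k q) * pdx \<psi> q"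
    "pdy \<sigma> q = \<sigma>z q * pdy \<rho> q + (kz q + P' q * k q) * pdy \<psi> q" if "q \<in> W" for q
    using that by (simp_all add: P'_def k_def kz_def \<sigma>_def \<sigma>z_def rules field_simps power2_eq_square)
  have "P (\<rho> q, \<psi> q) = P' q" "Q (\<rho> q, \<psi> q) = Q' q" for q
    by (simp_all add: P_def P'_def Q_def Q'_def power2_eq_square power3_eq_cube)
  note coeffs = coeffs[unfolded this]
  have inv: "pdy (pdy A) q = 0" "3 * pdy (pdy B) q - 2 * pdx (pdy A) q - 2 * A q * pdy A q = 0"
    if "q \<in> W" for q
    by (rule lie_invariants_vanish[OF smr smP J dP dQ dk d\<sigma> coeffs that]; assumption)+
  have "pdy (pdy F) q = 0" if "q \<in> W" for q
    by (rule second_derivative_vanishes[OF smF inv[unfolded A_def B_def] that])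
  then show ?thesis using affine_if_second_derivative_vanishes[OF W(1) smF _ W(2)] by blast
qed

lemma linear_ode_imp_affine:
  assumes U: "open U" "smooth_on U F" "p \<in> U" and pV: "p \<in> V" and pt: "point_transformation V \<rho> \<psi>"
    and K: "open K" "\<rho> ` V \<subseteq> K" and abc: "smooth_on K a" "smooth_on K b" "smooth_on K c"
    and maps: "maps_ode V \<rho> \<psi> (riccati_abel_chain F 2) (linear_ode2 a b c)"
  shows "\<exists>W \<alpha> \<beta>. open W \<and> p \<in> W \<and> smooth_on (fst ` W) \<alpha> \<and> smooth_on (fst ` W) \<beta> \<and>
    (\<forall>(x, y)\<in>W. F (x, y) = \<alpha> x * y + \<beta> x)"
  by (rule affine_if_mapped_to_linearizable_form[OF U pV pt K abc(1) smooth_on_const[OF K(1), of 0]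
        smooth_on_uminus[OF K(1) abc(3)] abc(2) maps])
    (auto simp: linear_ode2_def)

lemma linear_coefficient_imp_affine:
  assumes U: "open U" "smooth_on U F" "p \<in> U" and pV: "p \<in> V" and pt: "point_transformation V \<rho> \<psi>"
    and K: "open K" "\<rho> ` V \<subseteq> K" and \<alpha>: "smooth_on K \<alpha>"
    and maps: "maps_ode V \<rho> \<psi> (riccati_abel_chain F 2) (riccati_abel_chain (\<lambda>(z, w). \<alpha> z * w) 2)"
  shows "\<exists>W \<alpha> \<beta>. open W \<and> p \<in> W \<and> smooth_on (fst ` W) \<alpha> \<and> smooth_on (fst ` W) \<beta> \<and>
    (\<forall>(x, y)\<in>W. F (x, y) = \<alpha> x * y + \<beta> x)"
proof -
  have zero: "smooth_on K (\<lambda>_. 0 :: real)" by (rule smooth_on_const[OF K(1)])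
  show ?thesis
  proof (rule affine_if_mapped_to_linearizable_form[OF U pV pt K zero \<alpha> zero zero maps])
    fix J and w :: "real \<Rightarrow> real" and z assume "open J" "Ck_on 2 J w" "J \<subseteq> K" "z \<in> J"
    then show "riccati_abel_chain (\<lambda>(z, w). \<alpha> z * w) 2 w z \<longleftrightarrow>
      deriv (deriv w) z + (0 + 3 * \<alpha> z * w z) * deriv w z
      + (0 + 0 * w z + (deriv \<alpha> z + 0 * \<alpha> z) * (w z)\<^sup>2 + (\<alpha> z)\<^sup>2 * w z ^ 3) = 0"
      using chain_linear_coefficient[OF K(1) \<alpha>] by (simp add: add.assoc)
  qed
qed

section \<open>Equations with an affine coefficient are linearizable\<close>

text \<open>To show that a change of variables leads to \<open>w'' = 0\<close> it suffices to differentiate the slope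
  \<open>w' = g1 / h1\<close> of the transformed curve in the original variable.  The transformed tangent vector \<open>(h1, g1)\<close>
  is nonzero, and where it lies on a graph it is not vertical.\<close>

lemma second_derivative_from_slope:
  fixes h g s w :: "real \<Rightarrow> real"
  assumes I: "open I" and J: "open J" and w: "Ck_on 2 J w" and hJ: "\<And>x. x \<in> I \<Longrightarrow> h x \<in> J"
    and g: "\<And>x. x \<in> I \<Longrightarrow> w (h x) = g x"
    and h1: "\<And>x. x \<in> I \<Longrightarrow> (h has_real_derivative h1 x) (at x)"
    and g1: "\<And>x. x \<in> I \<Longrightarrow> (g has_real_derivative g1 x) (at x)"
    and immersed: "\<And>x. x \<in> I \<Longrightarrow> h1 x = 0 \<Longrightarrow> g1 x \<noteq> 0"
    and slope: "\<And>x. x \<in> I \<Longrightarrow> h1 x \<noteq> 0 \<Longrightarrow> g1 x = s x * h1 x"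
    and s1: "\<And>x. x \<in> I \<Longrightarrow> h1 x \<noteq> 0 \<Longrightarrow> (s has_real_derivative s1 x) (at x)"
    and x: "x \<in> I"
  shows "h1 x \<noteq> 0" "deriv (deriv w) (h x) * h1 x = s1 x"
proof -
  have ev: "eventually (\<lambda>x. x \<in> I) (nhds x)" if "x \<in> I" for x
    using I that by (auto simp: eventually_nhds)
  have 1: "g1 x = deriv w (h x) * h1 x" if "x \<in> I" for x
  proof -
    have "((\<lambda>x. w (h x)) has_real_derivative deriv w (h x) * h1 x) (at x)"
      by (rule DERIV_chain2[OF Ck_on_2_D(1)[OF J w hJ[OF that]] h1[OF that]])
    moreover have "((\<lambda>x. w (h x)) has_real_derivative g1 x) (at x)"
      using g1[OF that] has_field_derivative_transform_within_open[OF _ I that] g by metis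
    ultimately show ?thesis using DERIV_unique by blast
  qed
  have nz: "h1 x \<noteq> 0" if "x \<in> I" for x using 1[OF that] immersed[OF that] by auto
  show "h1 x \<noteq> 0" by (rule nz[OF x])
  have 2: "deriv w (h x) = s x" if "x \<in> I" for x
    using 1[OF that] slope[OF that nz[OF that]] nz[OF that] by simp
  have "((\<lambda>x. deriv w (h x)) has_real_derivative deriv (deriv w) (h x) * h1 x) (at x)"
    by (rule DERIV_chain2[OF Ck_on_2_D(2)[OF J w hJ[OF x]] h1[OF x]])
  moreover have "((\<lambda>x. deriv w (h x)) has_real_derivative s1 x) (at x)"
    using s1[OF x nz[OF x]] has_field_derivative_transform_within_open[OF _ I x] 2 by metis
  ultimately show "deriv (deriv w) (h x) * h1 x = s1 x" using DERIV_unique by blast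
qed

lemma antiderivative_on_interval:
  fixes f :: "real \<Rightarrow> real"
  assumes "continuous_on {a..b} f" "a < c" "c < b"
  obtains g where "g c = 0" "\<And>x. a < x \<Longrightarrow> x < b \<Longrightarrow> (g has_real_derivative f x) (at x)"
proof -
  obtain g where g: "\<And>x. x \<in> {a..b} \<Longrightarrow> (g has_vector_derivative f x) (at x within {a..b})"
    using antiderivative_continuous[OF assms(1)] by metis
  have "((\<lambda>x. g x - g c) has_real_derivative f x) (at x)" if "a < x" "x < b" for x
  proof -
    have "(g has_real_derivative f x) (at x within {a..b})"
      using g[of x] that by (simp add: has_real_derivative_iff_has_vector_derivative)
    then have "(g has_real_derivative f x) (at x)"
      using at_within_Icc_at[OF that] by simp
    then show ?thesis by (auto intro!: derivative_eq_intros)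
  qed
  then show ?thesis using that[of "\<lambda>x. g x - g c"] by simp
qed

text \<open>The factor \<open>g = exp (\<integral>\<beta>)\<close> absorbs the part of \<open>F\<close> that is independent of \<open>y\<close>.\<close>

locale affine_coefficient =
  fixes X Y :: "real set" and \<alpha> \<beta> g :: "real \<Rightarrow> real" and F :: "real \<times> real \<Rightarrow> real"
  assumes X: "open X" and Y: "open Y"
    and sm: "smooth_on X \<alpha>" "smooth_on X \<beta>"
    and g1: "\<And>x. x \<in> X \<Longrightarrow> (g has_real_derivative \<beta> x * g x) (at x)"
    and g_pos: "\<And>x. g x > 0" and g_smooth: "smooth_on X g"
    and F: "\<And>x y. x \<in> X \<Longrightarrow> y \<in> Y \<Longrightarrow> F (x, y) = \<alpha> x * y + \<beta> x"
begin

lemma open_XY: "open (X \<times> Y)" by (intro open_Times X Y)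

lemma smooth_of_x: "open V \<Longrightarrow> V \<subseteq> X \<times> Y \<Longrightarrow> smooth_on X f \<Longrightarrow> smooth_on V (\<lambda>q. f (fst q))"
  for f :: "real \<Rightarrow> real"
  by (rule smooth_on_compose[OF _ X _ _ smooth_on_fst]) auto

lemma smooth_F: "smooth_on (X \<times> Y) F"
proof -
  have "smooth_on (X \<times> Y) (\<lambda>q. \<alpha> (fst q) * snd q + \<beta> (fst q))"
    by (intro smooth_intros smooth_of_x open_XY order_refl sm)
  then show ?thesis
    using smooth_on_cong[OF open_XY, of F "\<lambda>q. \<alpha> (fst q) * snd q + \<beta> (fst q)"] F by auto
qed

text \<open>For \<open>w = g y\<close> one has \<open>\<Omega>[w] = g \<Omega>\<^sub>F[y]\<close>, and likewise for the second iterate, when the operator on the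
  left has the coefficient \<open>(\<alpha> / g) w\<close>.\<close>

lemma scaling_to_linear_coefficient:
  "point_transformation (X \<times> Y) fst (\<lambda>(x, y). g x * y)"
  "maps_ode (X \<times> Y) fst (\<lambda>(x, y). g x * y) (riccati_abel_chain F 2)
    (riccati_abel_chain (\<lambda>(z, w). \<alpha> z / g z * w) 2)"
proof -
  have g0: "g x \<noteq> 0" for x using g_pos[of x] by simp
  have sm_g: "smooth_on (X \<times> Y) (\<lambda>q. g (fst q) * snd q)"
    by (intro smooth_intros smooth_of_x open_XY order_refl g_smooth)
  have py: "pdy (\<lambda>q. g (fst q) * snd q) p = g (fst p)" for p
    unfolding pdy_def by (auto intro!: DERIV_imp_deriv derivative_eq_intros)
  have px: "pdx fst = (\<lambda>p. 1)" "pdy fst = (\<lambda>p. 0)"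
    by (auto simp: pdx_def pdy_def)
  show "point_transformation (X \<times> Y) fst (\<lambda>(x, y). g x * y)"
    unfolding point_transformation_def using sm_g
    by (auto simp: open_XY smooth_on_fst py px g0 case_prod_unfold)
  show "maps_ode (X \<times> Y) fst (\<lambda>(x, y). g x * y) (riccati_abel_chain F 2)
    (riccati_abel_chain (\<lambda>(z, w). \<alpha> z / g z * w) 2)"
    unfolding maps_ode_def
  proof (intro allI impI ballI)
    fix I J y w x
    assume *: "open I \<and> open J \<and> Ck_on 2 I y \<and> Ck_on 2 J w \<and>
      (\<forall>x\<in>I. (x, y x) \<in> X \<times> Y \<and> fst (x, y x) \<in> J \<and> w (fst (x, y x)) = (\<lambda>(x, y). g x * y) (x, y x))"
      and x: "x \<in> I"
    then have I: "open I" and y: "Ck_on 2 I y" and J: "open J" "Ck_on 2 J w" "I \<subseteq> J"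
      and graph: "\<forall>x\<in>I. (x, y x) \<in> X \<times> Y"
      and w: "\<And>x. x \<in> I \<Longrightarrow> w x = g x * y x" by auto
    have wI: "Ck_on 2 I w" by (rule Ck_on_subset[OF J(2,3)])
    have graph': "\<forall>x\<in>I. (x, w x) \<in> X \<times> UNIV" using graph by auto
    have sm': "smooth_on X (\<lambda>z. \<alpha> z / g z)" by (intro smooth_intros X sm g_smooth g0)
    note l = smooth_on_linear_coefficient[OF X sm']
    let ?F = "\<lambda>(z, w). \<alpha> z / g z * w"
    note o = Omega_iterates[OF open_XY smooth_F I y graph]
      and o' = Omega_iterates[OF l(1,2) I wI graph']
    have eta: "Omega ?F w w x = g x * Omega F y y x" if "x \<in> I" for x
    proof -
      have xX: "x \<in> X" "y x \<in> Y" using graph that by auto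
      have "(w has_real_derivative \<beta> x * g x * y x + (Omega F y y x - F (x, y x) * y x) * g x) (at x)"
        using DERIV_mult[OF g1[OF xX(1)] o(1)[OF that]] w
          has_field_derivative_transform_within_open[OF _ I that] by (smt (verit, best))
      then have "Omega ?F w w x - ?F (x, w x) * w x
          = \<beta> x * g x * y x + (Omega F y y x - F (x, y x) * y x) * g x"
        using o'(1)[OF that] DERIV_unique by blast
      then show ?thesis using w[OF that] F[OF xX] g0[of x] by (simp add: field_simps power2_eq_square)
    qed
    have xX: "x \<in> X" "y x \<in> Y" using graph x by auto
    have "(Omega ?F w w has_real_derivative \<beta> x * g x * Omega F y y x
        + (Omega F y (Omega F y y) x - F (x, y x) * Omega F y y x) * g x) (at x)"
      using DERIV_mult[OF g1[OF xX(1)] o(2)[OF x]] eta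
        has_field_derivative_transform_within_open[OF _ I x] by (smt (verit, best))
    then have "Omega ?F w (Omega ?F w w) x - ?F (x, w x) * Omega ?F w w x
        = \<beta> x * g x * Omega F y y x + (Omega F y (Omega F y y) x - F (x, y x) * Omega F y y x) * g x"
      using o'(2)[OF x] DERIV_unique by blast
    then have "Omega ?F w (Omega ?F w w) x = g x * Omega F y (Omega F y y) x"
      using w[OF x] F[OF xX] g0[of x] eta[OF x] by (simp add: field_simps)
    then show "riccati_abel_chain F 2 y x \<longleftrightarrow> riccati_abel_chain ?F 2 w (fst (x, y x))"
      using o(3)[OF x] o'(3)[OF x] g0[of x] by simp
  qed
qed

text \<open>The numerators and the common denominator are the homogeneous coordinates in which solution curves are
  straight lines.  Along any curve each of these three functions \<open>f\<close> has a derivative of the form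
  \<open>f' = - \<alpha> y f + \<dots>\<close>; the common term drops out of quotients.  The slope becomes \<open>g \<eta> / R\<close>, and its
  derivative is a nonvanishing multiple of \<open>\<theta> = \<Omega>\<^sub>F\<^sup>2[y]\<close>.\<close>

lemma linearization:
  assumes m0: "\<And>x. x \<in> X \<Longrightarrow> (m0 has_real_derivative \<alpha> x / g x) (at x)"
    and m1: "\<And>x. x \<in> X \<Longrightarrow> (m1 has_real_derivative x * \<alpha> x / g x) (at x)"
  defines "V \<equiv> {q \<in> X \<times> Y. 1 - g (fst q) * m0 (fst q) * snd q \<noteq> 0}"
    and "\<rho> \<equiv> \<lambda>q. (fst q - g (fst q) * m1 (fst q) * snd q) / (1 - g (fst q) * m0 (fst q) * snd q)"
    and "\<psi> \<equiv> \<lambda>q. g (fst q) * snd q / (1 - g (fst q) * m0 (fst q) * snd q)"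
  shows "point_transformation V \<rho> \<psi>"
    "maps_ode V \<rho> \<psi> (riccati_abel_chain F 2) free_particle_ode"
proof -
  have g0: "g x \<noteq> 0" for x using g_pos[of x] by simp
  have smm: "smooth_on X m0" "smooth_on X m1"
    by (rule smooth_on_antiderivative[OF X m0], assumption, intro smooth_intros X sm g_smooth g0)
      (rule smooth_on_antiderivative[OF X m1], assumption, intro smooth_intros X sm g_smooth g0)
  have VXY: "V \<subseteq> X \<times> Y" by (auto simp: V_def)
  have V: "open V"
  proof -
    have "smooth_on (X \<times> Y) (\<lambda>q. 1 - g (fst q) * m0 (fst q) * snd q)"
      by (intro smooth_intros smooth_of_x open_XY order_refl g_smooth smm)
    then have "continuous_on (X \<times> Y) (\<lambda>q. 1 - g (fst q) * m0 (fst q) * snd q)"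
      unfolding smooth_on_def by (metis Ck_on.simps(1))
    then have "open ((X \<times> Y) \<inter> (\<lambda>q. 1 - g (fst q) * m0 (fst q) * snd q) -` (- {0}))"
      by (intro continuous_open_preimage open_XY) auto
    moreover have "V = (X \<times> Y) \<inter> (\<lambda>q. 1 - g (fst q) * m0 (fst q) * snd q) -` (- {0})"
      by (auto simp: V_def)
    ultimately show ?thesis by simp
  qed
  have sm\<rho>: "smooth_on V \<rho>" "smooth_on V \<psi>"
    unfolding \<rho>_def \<psi>_def
    by (intro smooth_intros smooth_of_x V VXY g_smooth smm; auto simp: V_def)+
  have jac: "pdx \<rho> p * pdy \<psi> p - pdy \<rho> p * pdx \<psi> p \<noteq> 0" if "p \<in> V" for p
  proof -
    obtain x y where p: "p = (x, y)" by fastforce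
    have x: "x \<in> X" and nz: "1 - g x * m0 x * y \<noteq> 0" using that by (auto simp: V_def p)
    define u where "u = 1 - g x * m0 x * y"
    define ux where "ux = - (\<beta> x * g x * m0 x + \<alpha> x) * y"
    define nx where "nx = 1 - (\<beta> x * g x * m1 x + x * \<alpha> x) * y"
    note ders = g1[OF x] m0[OF x] m1[OF x]
    have 1: "pdx \<rho> p = (nx * u - (x - g x * m1 x * y) * ux) / (u * u)"
      unfolding pdx_def \<rho>_def p fst_conv snd_conv u_def nx_def ux_def
      by (rule DERIV_imp_deriv) (rule derivative_eq_intros ders refl | use nz g0[of x] in \<open>simp add: field_simps\<close>)+
    have 2: "pdx \<psi> p = (\<beta> x * g x * y * u - g x * y * ux) / (u * u)"
      unfolding pdx_def \<psi>_def p fst_conv snd_conv u_def nx_def ux_def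
      by (rule DERIV_imp_deriv) (rule derivative_eq_intros ders refl | use nz g0[of x] in \<open>simp add: field_simps\<close>)+
    have 3: "pdy \<rho> p = (- g x * m1 x * u + (x - g x * m1 x * y) * g x * m0 x) / (u * u)"
      unfolding pdy_def \<rho>_def p fst_conv snd_conv u_def nx_def ux_def
      by (rule DERIV_imp_deriv) (rule derivative_eq_intros refl | use nz g0[of x] in \<open>simp add: field_simps\<close>)+
    have 4: "pdy \<psi> p = (g x * u + g x * y * g x * m0 x) / (u * u)"
      unfolding pdy_def \<psi>_def p fst_conv snd_conv u_def nx_def ux_def
      by (rule DERIV_imp_deriv) (rule derivative_eq_intros refl | use nz g0[of x] in \<open>simp add: field_simps\<close>)+
    have "(nx * u - (x - g x * m1 x * y) * ux) * (g x * u + g x * y * g x * m0 x)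
      - (- g x * m1 x * u + (x - g x * m1 x * y) * g x * m0 x) * (\<beta> x * g x * y * u - g x * y * ux)
      = g x * u"
      unfolding u_def nx_def ux_def by algebra
    then have "pdx \<rho> p * pdy \<psi> p - pdy \<rho> p * pdx \<psi> p = g x * u / ((u * u) * (u * u))"
      unfolding 1 2 3 4 by (simp add: diff_divide_distrib[symmetric])
    then show ?thesis using nz g0[of x] by (simp add: u_def)
  qed
  show "point_transformation V \<rho> \<psi>"
    unfolding point_transformation_def using V sm\<rho> jac by blast
  show "maps_ode V \<rho> \<psi> (riccati_abel_chain F 2) free_particle_ode"
    unfolding maps_ode_def
  proof (intro allI impI ballI)
    fix I J y w x
    assume *: "open I \<and> open J \<and> Ck_on 2 I y \<and> Ck_on 2 J w \<and>
      (\<forall>x\<in>I. (x, y x) \<in> V \<and> \<rho> (x, y x) \<in> J \<and> w (\<rho> (x, y x)) = \<psi> (x, y x))"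
      and x: "x \<in> I"
    then have I: "open I" and y: "Ck_on 2 I y" and J: "open J" "Ck_on 2 J w"
      and graphV: "\<And>x. x \<in> I \<Longrightarrow> (x, y x) \<in> V"
      and hJ: "\<And>x. x \<in> I \<Longrightarrow> \<rho> (x, y x) \<in> J"
      and w: "\<And>x. x \<in> I \<Longrightarrow> w (\<rho> (x, y x)) = \<psi> (x, y x)" by auto
    have graph: "\<forall>x\<in>I. (x, y x) \<in> X \<times> Y" using graphV VXY by blast
    note o = Omega_iterates[OF open_XY smooth_F I y graph]
    define \<eta> where "\<eta> = Omega F y y"
    define \<theta> where "\<theta> = Omega F y (Omega F y y)"
    define u where "u = (\<lambda>x. 1 - g x * m0 x * y x)"
    define R where "R = (\<lambda>x. u x + g x * \<eta> x * (x * m0 x - m1 x))"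
    have xX: "x \<in> X" and Fx: "F (x, y x) = \<alpha> x * y x + \<beta> x" and u0: "u x \<noteq> 0" if "x \<in> I" for x
      using graphV[OF that] F by (auto simp: V_def u_def)
    have y1: "(y has_real_derivative \<eta> x - (\<alpha> x * y x + \<beta> x) * y x) (at x)" if "x \<in> I" for x
      using o(1)[OF that] Fx[OF that] by (simp add: \<eta>_def)
    have \<eta>1: "(\<eta> has_real_derivative \<theta> x - (\<alpha> x * y x + \<beta> x) * \<eta> x) (at x)" if "x \<in> I" for x
      using o(2)[OF that] Fx[OF that] by (simp add: \<eta>_def \<theta>_def)
    have u1: "(u has_real_derivative - \<alpha> x * y x * u x - g x * m0 x * \<eta> x) (at x)" if "x \<in> I" for x
      unfolding u_def
      by (rule derivative_eq_intros refl g1 m0 y1 xX that | use g0[of x] in \<open>simp add: field_simps\<close>)+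
    have h1: "((\<lambda>x. \<rho> (x, y x)) has_real_derivative R x / (u x)\<^sup>2) (at x)" if "x \<in> I" for x
    proof -
      have "((\<lambda>x. x - g x * m1 x * y x) has_real_derivative
          1 - \<alpha> x * y x * (x - g x * m1 x * y x) - g x * m1 x * \<eta> x) (at x)"
        by (rule derivative_eq_intros refl g1 m1 y1 xX that | use g0[of x] in \<open>simp add: field_simps\<close>)+
      from DERIV_divide[OF this u1[OF that] u0[OF that]]
      moreover have "(\<lambda>x. \<rho> (x, y x)) = (\<lambda>x. (x - g x * m1 x * y x) / u x)"
        by (simp add: \<rho>_def u_def)
      ultimately show ?thesis
        by (elim ssubst, elim DERIV_cong) (use u0[OF that] in \<open>simp add: R_def u_def field_simps power2_eq_square\<close>)
    qed
    have g1': "((\<lambda>x. \<psi> (x, y x)) has_real_derivative g x * \<eta> x / (u x)\<^sup>2) (at x)" if "x \<in> I" for x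
    proof -
      have "((\<lambda>x. g x * y x) has_real_derivative g x * \<eta> x - \<alpha> x * y x * (g x * y x)) (at x)"
        by (rule derivative_eq_intros refl g1 y1 xX that | simp add: algebra_simps)+
      from DERIV_divide[OF this u1[OF that] u0[OF that]]
      moreover have "(\<lambda>x. \<psi> (x, y x)) = (\<lambda>x. g x * y x / u x)"
        by (simp add: \<psi>_def u_def)
      ultimately show ?thesis
        by (elim ssubst, elim DERIV_cong) (use u0[OF that] in \<open>simp add: u_def field_simps power2_eq_square\<close>)
    qed
    have s1: "((\<lambda>x. g x * \<eta> x / R x) has_real_derivative g x * \<theta> x * u x / (R x)\<^sup>2) (at x)"
      if "x \<in> I" "R x \<noteq> 0" for x
    proof -
      have "((\<lambda>x. g x * \<eta> x) has_real_derivative g x * \<theta> x - \<alpha> x * y x * (g x * \<eta> x)) (at x)"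
        by (rule derivative_eq_intros refl g1 \<eta>1 xX that | simp add: algebra_simps)+
      moreover have "(R has_real_derivative g x * \<theta> x * (x * m0 x - m1 x) - \<alpha> x * y x * R x) (at x)"
        unfolding R_def
        by (rule derivative_eq_intros refl g1 \<eta>1 xX that(1) u1 m0 m1 | use g0[of x] in \<open>simp add: field_simps\<close>)+
      ultimately show ?thesis
        by (rule DERIV_divide[THEN DERIV_cong]) (use that(2) in \<open>simp_all add: R_def field_simps power2_eq_square\<close>)
    qed
    have R0: "R x \<noteq> 0" if "x \<in> I" "R x / (u x)\<^sup>2 \<noteq> 0" for x using that by simp
    have immersed: "g x * \<eta> x / (u x)\<^sup>2 \<noteq> 0" if "x \<in> I" "R x / (u x)\<^sup>2 = 0" for x
    proof -
      have "R x = 0" using that u0 by simp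
      then have "\<eta> x \<noteq> 0" using u0[OF that(1)] by (auto simp: R_def)
      then show ?thesis using g0 u0[OF that(1)] by simp
    qed
    have slope: "g x * \<eta> x / (u x)\<^sup>2 = g x * \<eta> x / R x * (R x / (u x)\<^sup>2)"
      if "x \<in> I" "R x / (u x)\<^sup>2 \<noteq> 0" for x using R0[OF that] by simp
    have "R x / (u x)\<^sup>2 \<noteq> 0"
      "deriv (deriv w) (\<rho> (x, y x)) * (R x / (u x)\<^sup>2) = g x * \<theta> x * u x / (R x)\<^sup>2"
      by (rule second_derivative_from_slope[OF I J hJ w h1 g1' immersed slope s1[OF _ R0] x]; assumption)+
    then show "riccati_abel_chain F 2 y x \<longleftrightarrow> free_particle_ode w (\<rho> (x, y x))"
      using o(3)[OF x] g0[of x] u0[OF x] by (auto simp: free_particle_ode_def \<theta>_def)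
  qed
qed

end

text \<open>The box is chosen so small that the antiderivatives exist on its first side; the interval is halved
  because \<open>m0\<close> and \<open>m1\<close> are integrals involving \<open>g\<close>, which must be continuous up to the boundary.\<close>

lemma affine_coefficient_locally:
  fixes F :: "real \<times> real \<Rightarrow> real"
  assumes V: "open V" "(x0, y0) \<in> V" and sm: "smooth_on (fst ` V) \<alpha>" "smooth_on (fst ` V) \<beta>"
    and F: "\<forall>(x, y)\<in>V. F (x, y) = \<alpha> x * y + \<beta> x"
  obtains X Y g m0 m1 where "affine_coefficient X Y \<alpha> \<beta> g F" "x0 \<in> X" "y0 \<in> Y" "m0 x0 = 0"
    "\<And>x. x \<in> X \<Longrightarrow> (m0 has_real_derivative \<alpha> x / g x) (at x)"
    "\<And>x. x \<in> X \<Longrightarrow> (m1 has_real_derivative x * \<alpha> x / g x) (at x)"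
proof -
  obtain X' Y where XY: "open X'" "open Y" "x0 \<in> X'" "y0 \<in> Y" "X' \<times> Y \<subseteq> V"
    using V by (metis open_prod_elim mem_Sigma_iff)
  obtain e where e: "e > 0" "cball x0 e \<subseteq> X'" using XY open_contains_cball by blast
  have X'V: "X' \<subseteq> fst ` V" using XY by force
  have smX': "smooth_on X' \<alpha>" "smooth_on X' \<beta>" using sm smooth_on_subset[OF _ X'V] by blast+
  have cont: "continuous_on S f" if "smooth_on T f" "S \<subseteq> T" for f :: "real \<Rightarrow> real" and S T
    using that continuous_on_subset unfolding smooth_on_def by (metis Ck_on.simps(1))
  define Z where "Z = {x0 - e<..<x0 + e}"
  define X where "X = {x0 - e/2<..<x0 + e/2}"
  have Z: "open Z" "{x0 - e/2..x0 + e/2} \<subseteq> Z" using e(1) by (auto simp: Z_def)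
  have ZX': "{x0 - e..x0 + e} \<subseteq> X'" using e(2) by (simp add: cball_eq_atLeastAtMost)
  have X: "open X" "x0 \<in> X" "X \<subseteq> Z" using e(1) by (auto simp: X_def Z_def)
  have smZ: "smooth_on Z \<alpha>" "smooth_on Z \<beta>"
  proof -
    have "Z \<subseteq> X'" using ZX' by (auto simp: Z_def)
    then show "smooth_on Z \<alpha>" "smooth_on Z \<beta>" using smX' smooth_on_subset by blast+
  qed
  obtain B where B: "\<And>x. x0 - e < x \<Longrightarrow> x < x0 + e \<Longrightarrow> (B has_real_derivative \<beta> x) (at x)"
    using antiderivative_on_interval[OF cont[OF smX'(2) ZX'], of x0] e(1) by auto
  define g where "g = (\<lambda>x. exp (B x))"
  have B': "(B has_real_derivative \<beta> x) (at x)" if "x \<in> Z" for x using B that by (simp add: Z_def)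
  have g1: "(g has_real_derivative \<beta> x * g x) (at x)" if "x \<in> Z" for x
    unfolding g_def by (rule derivative_eq_intros B'[OF that] refl | simp)+
  have smg: "smooth_on Z g" unfolding g_def
    by (rule smooth_on_compose[OF Z(1) open_UNIV _ smooth_on_exp smooth_on_antiderivative[OF Z(1) B' smZ(2)]])
      auto
  have mid: "x0 - e/2 < x0" "x0 < x0 + e/2" using e(1) by auto
  have q0: "smooth_on Z (\<lambda>x. \<alpha> x / g x)"
    by (intro smooth_intros Z(1) smZ smg) (simp add: g_def)
  obtain m0 where m0: "m0 x0 = 0"
    "\<And>x. x0 - e/2 < x \<Longrightarrow> x < x0 + e/2 \<Longrightarrow> (m0 has_real_derivative \<alpha> x / g x) (at x)"
    by (rule antiderivative_on_interval[OF cont[OF q0 Z(2)] mid]) blast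
  have q1: "smooth_on Z (\<lambda>x. x * \<alpha> x / g x)"
    by (intro smooth_intros Z(1) smZ smg) (simp add: g_def)
  obtain m1 where m1:
    "\<And>x. x0 - e/2 < x \<Longrightarrow> x < x0 + e/2 \<Longrightarrow> (m1 has_real_derivative x * \<alpha> x / g x) (at x)"
    by (rule antiderivative_on_interval[OF cont[OF q1 Z(2)] mid]) blast
  have m01: "(m0 has_real_derivative \<alpha> x / g x) (at x)" "(m1 has_real_derivative x * \<alpha> x / g x) (at x)"
    if "x \<in> X" for x
    using that m0(2) m1 by (simp_all add: X_def)
  have affine: "affine_coefficient X Y \<alpha> \<beta> g F"
  proof
    show "open X" "open Y" by fact+
    show "smooth_on X \<alpha>" "smooth_on X \<beta>" "smooth_on X g"
      using smZ smg X(3) smooth_on_subset by blast+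
    show "(g has_real_derivative \<beta> x * g x) (at x)" if "x \<in> X" for x using g1 that X(3) by blast
    show "g x > 0" for x by (simp add: g_def)
    show "F (x, y) = \<alpha> x * y + \<beta> x" if "x \<in> X" "y \<in> Y" for x y
      
    proof -
      have "x \<in> {x0 - e..x0 + e}" using that(1) X(3) by (auto simp: Z_def)
      then have "(x, y) \<in> V" using ZX' XY(5) that(2) by blast
      then show ?thesis using F by blast
    qed
  qed
  show thesis by (rule that[OF affine X(2) XY(4) m0(1) m01])
qed

lemma linearizable_near_if_free_particle:
  assumes "p \<in> V" "point_transformation V \<rho> \<psi>" "maps_ode V \<rho> \<psi> E free_particle_ode"
  shows "linearizable_near E p"
proof -
  have "free_particle_ode = linear_ode2 (\<lambda>_. 0) (\<lambda>_. 0) (\<lambda>_. 0)"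
    by (intro ext) (simp add: free_particle_ode_def linear_ode2_def)
  moreover have "smooth_on UNIV (\<lambda>_ :: real. 0 :: real)" by (rule smooth_on_const[OF open_UNIV])
  ultimately show ?thesis
    unfolding linearizable_near_def using assms
    by (intro exI[of _ V] exI[of _ \<rho>] exI[of _ \<psi>] exI[of _ UNIV] exI[of _ "\<lambda>_. 0"] conjI) auto
qed

lemma affine_imp_linearizable:
  assumes "open V" "(x0, y0) \<in> V" "smooth_on (fst ` V) \<alpha>" "smooth_on (fst ` V) \<beta>"
    "\<forall>(x, y)\<in>V. F (x, y) = \<alpha> x * y + \<beta> x"
  shows "linearizable_near (riccati_abel_chain F 2) (x0, y0)"
proof -
  obtain X Y g m0 m1 where aff: "affine_coefficient X Y \<alpha> \<beta> g F" and p: "x0 \<in> X" "y0 \<in> Y" "m0 x0 = 0"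
    and m: "\<And>x. x \<in> X \<Longrightarrow> (m0 has_real_derivative \<alpha> x / g x) (at x)"
    "\<And>x. x \<in> X \<Longrightarrow> (m1 has_real_derivative x * \<alpha> x / g x) (at x)"
    by (rule affine_coefficient_locally[OF assms]) (rule that)
  note l = affine_coefficient.linearization[OF aff m]
  show ?thesis
    by (rule linearizable_near_if_free_particle[OF _ l]) (use p in simp)
qed

lemma affine_imp_linear_coefficient:
  assumes "open V" "(x0, y0) \<in> V" "smooth_on (fst ` V) \<alpha>" "smooth_on (fst ` V) \<beta>"
    "\<forall>(x, y)\<in>V. F (x, y) = \<alpha> x * y + \<beta> x"
  shows "\<exists>V \<rho> \<psi> K \<alpha>. (x0, y0) \<in> V \<and> point_transformation V \<rho> \<psi> \<and> open K \<and> \<rho> ` V \<subseteq> K \<and>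
    smooth_on K \<alpha> \<and> maps_ode V \<rho> \<psi> (riccati_abel_chain F 2) (riccati_abel_chain (\<lambda>(z, w). \<alpha> z * w) 2)"
proof -
  obtain X Y g m0 m1 where aff: "affine_coefficient X Y \<alpha> \<beta> g F" and p: "x0 \<in> X" "y0 \<in> Y"
    by (rule affine_coefficient_locally[OF assms]) (rule that)
  interpret affine_coefficient X Y \<alpha> \<beta> g F by (rule aff)
  have "smooth_on X (\<lambda>z. \<alpha> z / g z)"
    using g_pos by (intro smooth_intros X sm g_smooth) (simp add: less_imp_neq[symmetric])
  moreover have "(x0, y0) \<in> X \<times> Y" using p by simp
  moreover have "fst ` (X \<times> Y) \<subseteq> X" by auto
  ultimately show ?thesis using scaling_to_linear_coefficient X
    by (intro exI[of _ "X \<times> Y"] exI[of _ fst] exI[of _ "\<lambda>(x, y). g x * y"] exI[of _ X]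
        exI[of _ "\<lambda>z. \<alpha> z / g z"] conjI)
qed

section \<open>The linearizing family\<close>

text \<open>From \<open>(x - 1) / ((k\<^sub>5 - 1) (k\<^sub>5 - x)) = 1 / (k\<^sub>5 - x) - 1 / (k\<^sub>5 - 1)\<close> the long formula collapses: up to an affine
  function of \<open>\<rho>\<close>, the new dependent variable is \<open>k\<^sub>6 \<rho> / (k\<^sub>5 - x) + S\<close>.\<close>

lemma family_psi_eq:
  assumes "x \<noteq> k5" "y \<noteq> 0" "k3 \<noteq> 0" "k5 \<noteq> 1"
  shows "family_psi k1 k2 k3 k4 k5 k6 T S (x, y)
    = (k4 - k6 / (k5 - 1) + k6 / (k5 - x)) * family_rho k1 k3 k5 T (x, y) + k2 + S x"
  using assms unfolding family_psi_def family_rho_def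
  by (simp add: divide_simps) (simp add: algebra_simps)

text \<open>Along a curve the slope is \<open>c + k\<^sub>6 \<eta> / (y + (k\<^sub>5 - x) \<eta>)\<close> with \<open>c = k\<^sub>4 - k\<^sub>6 / (k\<^sub>5 - 1)\<close> and \<open>\<eta> = \<Omega>\<^sub>F[y]\<close>.
  Its derivative is \<open>k\<^sub>6 y \<theta> / (y + (k\<^sub>5 - x) \<eta>)\<^sup>2\<close> with \<open>\<theta> = \<Omega>\<^sub>F\<^sup>2[y]\<close>, which vanishes exactly when \<open>\<theta>\<close> does.\<close>

lemma family_linearizes:
  fixes \<alpha> T S :: "real \<Rightarrow> real" and I :: "real set" and k1 k2 k3 k4 k5 k6 :: real
  assumes I: "open I" and \<alpha>: "smooth_on I \<alpha>" and k: "k3 * k6 \<noteq> 0" "k5 \<noteq> 1" "k5 \<notin> I"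
    and T': "\<forall>x\<in>I. (T has_real_derivative (k5 - x) * \<alpha> x / k3) (at x)"
    and S': "\<forall>x\<in>I. (S has_real_derivative k6 * (k1 - T x) / (k5 - x)\<^sup>2) (at x)"
  defines "\<rho> \<equiv> family_rho k1 k3 k5 T" and "\<psi> \<equiv> family_psi k1 k2 k3 k4 k5 k6 T S"
  shows "point_transformation (I \<times> {y. y \<noteq> 0}) \<rho> \<psi>"
    and "maps_ode (I \<times> {y. y \<noteq> 0}) \<rho> \<psi> (riccati_abel_chain (\<lambda>(x, y). \<alpha> x * y) 2) free_particle_ode"
proof -
  note T = T'[rule_format] and S = S'[rule_format]
  define V where "V = I \<times> {y :: real. y \<noteq> 0}"
  define c where "c = k4 - k6 / (k5 - 1)"
  have k36: "k3 \<noteq> 0" "k6 \<noteq> 0" using k by auto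
  have xk: "k5 - x \<noteq> 0" if "x \<in> I" for x using that k(3) by auto
  have V: "open V" unfolding V_def by (intro open_Times I open_Collect_neq continuous_intros)
  have \<rho>: "\<rho> = (\<lambda>q. (fst q - k5) / (k3 * snd q) - k1 + T (fst q))"
    by (auto simp: \<rho>_def family_rho_def)
  have \<psi>: "\<psi> (x, y) = (c + k6 / (k5 - x)) * \<rho> (x, y) + k2 + S x" if "x \<in> I" "y \<noteq> 0" for x y
    unfolding \<rho>_def \<psi>_def c_def by (rule family_psi_eq) (use that k k36 in auto)
  define \<psi>' where "\<psi>' = (\<lambda>q. (c + k6 / (k5 - fst q)) * \<rho> q + k2 + S (fst q))"
  have \<psi>\<psi>': "\<forall>q\<in>V. \<psi> q = \<psi>' q" using \<psi> by (auto simp: V_def \<psi>'_def)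
  have smT: "smooth_on I T"
    by (rule smooth_on_antiderivative[OF I T]) (auto intro!: smooth_intros I \<alpha> simp: k36)
  have smS: "smooth_on I S"
    by (rule smooth_on_antiderivative[OF I S]) (use xk in \<open>auto intro!: smooth_intros I smT\<close>)
  have sm_fst: "smooth_on V (\<lambda>q. f (fst q))" if "smooth_on I f" for f :: "real \<Rightarrow> real"
    by (rule smooth_on_compose[OF V I _ that smooth_on_fst[OF V]]) (auto simp: V_def)
  have sm\<rho>: "smooth_on V \<rho>"
    unfolding \<rho> by (intro smooth_intros V sm_fst smT) (auto simp: V_def k36)
  have "smooth_on V \<psi>'"
    unfolding \<psi>'_def by (intro smooth_intros V sm_fst smS sm\<rho>) (use k(3) in \<open>auto simp: V_def\<close>)
  then have sm\<psi>: "smooth_on V \<psi>" using smooth_on_cong[OF V, of \<psi> \<psi>'] \<psi>\<psi>' by blast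
  have jac: "pdx \<rho> p * pdy \<psi> p - pdy \<rho> p * pdx \<psi> p \<noteq> 0" if p: "p \<in> V" for p
  proof -
    obtain x y where pxy: "p = (x, y)" by fastforce
    have x: "x \<in> I" and y: "y \<noteq> 0" using p by (auto simp: V_def pxy)
    note t = xk[OF x]
    define rx ry where "rx = 1 / (k3 * y) + (k5 - x) * \<alpha> x / k3" and "ry = (k5 - x) / (k3 * y\<^sup>2)"
    have 1: "((\<lambda>s. \<rho> (s, y)) has_real_derivative rx) (at x)"
      unfolding \<rho> fst_conv snd_conv rx_def
      by (rule derivative_eq_intros T x refl | use k36 y in \<open>simp add: field_simps\<close>)+
    have 2: "((\<lambda>s. \<rho> (x, s)) has_real_derivative ry) (at y)"
      unfolding \<rho> fst_conv snd_conv ry_def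
      by (rule derivative_eq_intros refl | use k36 y in \<open>simp add: field_simps power2_eq_square\<close>)+
    have 3: "((\<lambda>s. \<psi>' (s, y)) has_real_derivative (c + k6 / (k5 - x)) * rx
        + k6 / (k5 - x)\<^sup>2 * \<rho> (x, y) + k6 * (k1 - T x) / (k5 - x)\<^sup>2) (at x)"
      unfolding \<psi>'_def fst_conv snd_conv
      by (rule derivative_eq_intros 1 S x refl | use t in \<open>simp add: field_simps power2_eq_square\<close>)+
    have 4: "((\<lambda>s. \<psi>' (x, s)) has_real_derivative (c + k6 / (k5 - x)) * ry) (at y)"
      unfolding \<psi>'_def fst_conv snd_conv
      by (rule derivative_eq_intros 2 refl | simp)+
    have e: "pdx \<rho> p = rx" "pdy \<rho> p = ry" "pdx \<psi> p = (c + k6 / (k5 - x)) * rx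
        + k6 / (k5 - x)\<^sup>2 * \<rho> (x, y) + k6 * (k1 - T x) / (k5 - x)\<^sup>2" "pdy \<psi> p = (c + k6 / (k5 - x)) * ry"
      using 1 2 3 4 pd_cong[OF V p \<psi>\<psi>'] DERIV_imp_deriv by (simp_all add: pdx_def pdy_def pxy)
    have "pdx \<rho> p * pdy \<psi> p - pdy \<rho> p * pdx \<psi> p
      = - ry * (k6 / (k5 - x)\<^sup>2) * (\<rho> (x, y) + k1 - T x)"
      unfolding e by (simp add: algebra_simps diff_divide_distrib add_divide_distrib)
    also have "\<dots> = ry * (k6 / (k5 - x)\<^sup>2) * ((k5 - x) / (k3 * y))"
    proof -
      have "\<rho> (x, y) + k1 - T x = - ((k5 - x) / (k3 * y))"
        unfolding \<rho> by (simp add: minus_divide_left)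
      then show ?thesis by simp
    qed
    finally show ?thesis using k36 y t by (simp add: ry_def)
  qed
  show "point_transformation (I \<times> {y. y \<noteq> 0}) \<rho> \<psi>"
    unfolding point_transformation_def V_def[symmetric] using V sm\<rho> sm\<psi> jac by blast
  show "maps_ode (I \<times> {y. y \<noteq> 0}) \<rho> \<psi> (riccati_abel_chain (\<lambda>(x, y). \<alpha> x * y) 2) free_particle_ode"
    unfolding maps_ode_def V_def[symmetric]
  proof (intro allI impI ballI)
    fix I' J y w x
    assume *: "open I' \<and> open J \<and> Ck_on 2 I' y \<and> Ck_on 2 J w \<and>
      (\<forall>x\<in>I'. (x, y x) \<in> V \<and> \<rho> (x, y x) \<in> J \<and> w (\<rho> (x, y x)) = \<psi> (x, y x))"
      and x: "x \<in> I'"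
    then have I': "open I'" and y: "Ck_on 2 I' y" and J: "open J" "Ck_on 2 J w"
      and graphV: "\<And>x. x \<in> I' \<Longrightarrow> x \<in> I \<and> y x \<noteq> 0"
      and hJ: "\<And>x. x \<in> I' \<Longrightarrow> \<rho> (x, y x) \<in> J"
      and w: "\<And>x. x \<in> I' \<Longrightarrow> w (\<rho> (x, y x)) = \<psi> (x, y x)" by (auto simp: V_def)
    have graph: "\<forall>x\<in>I'. (x, y x) \<in> I \<times> UNIV" using graphV by auto
    let ?F = "\<lambda>(x, y). \<alpha> x * y"
    note l = smooth_on_linear_coefficient[OF I \<alpha>]
    note o = Omega_iterates[OF l(1,2) I' y graph]
    define \<eta> where "\<eta> = Omega ?F y y"
    define \<theta> where "\<theta> = Omega ?F y (Omega ?F y y)"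
    define R where "R = (\<lambda>x. y x + (k5 - x) * \<eta> x)"
    have xI: "x \<in> I" and y0: "y x \<noteq> 0" and t: "k5 - x \<noteq> 0" if "x \<in> I'" for x
      using graphV[OF that] xk by auto
    have y1: "(y has_real_derivative \<eta> x - \<alpha> x * y x * y x) (at x)" if "x \<in> I'" for x
      using o(1)[OF that] by (simp add: \<eta>_def)
    have \<eta>1: "(\<eta> has_real_derivative \<theta> x - \<alpha> x * y x * \<eta> x) (at x)" if "x \<in> I'" for x
      using o(2)[OF that] by (simp add: \<eta>_def \<theta>_def)
    have h1: "((\<lambda>x. \<rho> (x, y x)) has_real_derivative R x / (k3 * (y x)\<^sup>2)) (at x)" if "x \<in> I'" for x
      unfolding \<rho> fst_conv snd_conv R_def
      by (rule derivative_eq_intros T xI y1 that refl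
          | use k36 y0[OF that] in \<open>simp add: field_simps power2_eq_square\<close>)+
    have "((\<lambda>x. \<psi>' (x, y x)) has_real_derivative c * (R x / (k3 * (y x)\<^sup>2)) + k6 * \<eta> x / (k3 * (y x)\<^sup>2)) (at x)"
      if "x \<in> I'" for x
    proof -
      let ?H = "R x / (k3 * (y x)\<^sup>2)"
      have k: "((\<lambda>x. c + k6 / (k5 - x)) has_real_derivative k6 / (k5 - x)\<^sup>2) (at x)"
        by (rule derivative_eq_intros refl | use t[OF that] in \<open>simp add: power2_eq_square\<close>)+
      have "\<rho> (x, y x) + k1 - T x = - ((k5 - x) / (k3 * y x))"
        unfolding \<rho> by (simp add: minus_divide_left)
      then have \<rho>x: "\<rho> (x, y x) = T x - k1 - (k5 - x) / (k3 * y x)" by simp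
      have H: "?H = 1 / (k3 * y x) + (k5 - x) * (\<eta> x / (k3 * (y x)\<^sup>2))"
        using y0[OF that] by (simp add: R_def add_divide_distrib power2_eq_square)
      have "k6 / (k5 - x)\<^sup>2 * \<rho> (x, y x) + ?H * (c + k6 / (k5 - x)) + 0 + k6 * (k1 - T x) / (k5 - x)\<^sup>2
          = c * ?H + k6 / (k5 - x) * ?H - k6 / (k5 - x)\<^sup>2 * ((k5 - x) / (k3 * y x))"
        unfolding \<rho>x by (simp add: algebra_simps diff_divide_distrib add_divide_distrib)
      also have "k6 / (k5 - x)\<^sup>2 * ((k5 - x) / (k3 * y x)) = k6 / (k5 - x) * (1 / (k3 * y x))"
        using t[OF that] by (simp add: power2_eq_square)
      also have "c * ?H + k6 / (k5 - x) * ?H - k6 / (k5 - x) * (1 / (k3 * y x))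
          = c * ?H + k6 / (k5 - x) * (?H - 1 / (k3 * y x))"
        by (simp add: right_diff_distrib)
      also have "k6 / (k5 - x) * (?H - 1 / (k3 * y x)) = k6 * \<eta> x / (k3 * (y x)\<^sup>2)"
        unfolding H using t[OF that] by simp
      finally show ?thesis
        unfolding \<psi>'_def fst_conv snd_conv
        by (rule DERIV_cong[OF DERIV_add[OF DERIV_add[OF DERIV_mult[OF k h1[OF that]] DERIV_const] S[OF xI[OF that]]]])
    qed
    then have g1: "((\<lambda>x. \<psi> (x, y x)) has_real_derivative c * (R x / (k3 * (y x)\<^sup>2)) + k6 * \<eta> x / (k3 * (y x)\<^sup>2)) (at x)"
      if "x \<in> I'" for x
      by (rule has_field_derivative_transform_within_open[OF _ I' that])
        (use that \<psi>\<psi>' graphV in \<open>auto simp: V_def\<close>)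
    have s1: "((\<lambda>x. c + k6 * \<eta> x / R x) has_real_derivative k6 * y x * \<theta> x / (R x)\<^sup>2) (at x)"
      if "x \<in> I'" "R x \<noteq> 0" for x
    proof -
      have "(R has_real_derivative (k5 - x) * \<theta> x - \<alpha> x * y x * R x) (at x)"
        unfolding R_def
        by (rule derivative_eq_intros refl \<eta>1 y1 that(1) | simp add: algebra_simps)+
      note this [derivative_intros]
      show ?thesis
        by (rule derivative_eq_intros \<eta>1 \<open>(R has_real_derivative _) (at x)\<close> that refl
            | use that(2) in \<open>simp add: R_def field_simps power2_eq_square\<close>)+
    qed
    have R0: "R x \<noteq> 0" if "x \<in> I'" "R x / (k3 * (y x)\<^sup>2) \<noteq> 0" for x using that by simp
    have immersed: "c * (R x / (k3 * (y x)\<^sup>2)) + k6 * \<eta> x / (k3 * (y x)\<^sup>2) \<noteq> 0"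
      if "x \<in> I'" "R x / (k3 * (y x)\<^sup>2) = 0" for x
    proof -
      have "R x = 0" using that k36 y0 by simp
      then have "\<eta> x \<noteq> 0" using y0[OF that(1)] by (auto simp: R_def)
      then show ?thesis using k36 y0[OF that(1)] \<open>R x = 0\<close> by simp
    qed
    have slope: "c * (R x / (k3 * (y x)\<^sup>2)) + k6 * \<eta> x / (k3 * (y x)\<^sup>2)
        = (c + k6 * \<eta> x / R x) * (R x / (k3 * (y x)\<^sup>2))"
      if "x \<in> I'" "R x / (k3 * (y x)\<^sup>2) \<noteq> 0" for x
      using R0[OF that] by (simp add: distrib_right add_divide_distrib)
    have "R x / (k3 * (y x)\<^sup>2) \<noteq> 0"
      "deriv (deriv w) (\<rho> (x, y x)) * (R x / (k3 * (y x)\<^sup>2)) = k6 * y x * \<theta> x / (R x)\<^sup>2"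
      by (rule second_derivative_from_slope[OF I' J hJ w h1 g1 immersed slope s1[OF _ R0] x]; assumption)+
    then show "riccati_abel_chain ?F 2 y x \<longleftrightarrow> free_particle_ode w (\<rho> (x, y x))"
      using o(3)[OF x] y0[OF x] k36 by (auto simp: free_particle_ode_def \<theta>_def)
  qed
qed

section \<open>The characterization of linearizable equations of the chain\<close>

theorem theorem1:
  fixes F :: "real \<times> real \<Rightarrow> real" and U :: "(real \<times> real) set"
  assumes "open U" and "smooth_on U F"
  shows
    "(\<forall>I y. open I \<and> Ck_on 2 I y \<and> (\<forall>x\<in>I. (x, y x) \<in> U) \<longrightarrow>
        (\<forall>x\<in>I. riccati_abel_chain F 2 y x \<longleftrightarrow>
           deriv (deriv y) x
           + (2 * F (x, y x) + y x * pdy F (x, y x)) * deriv y x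
           + y x * ((F (x, y x))\<^sup>2 + pdx F (x, y x)) = 0))
     \<and>
     (\<forall>p\<in>U.
        (linearizable_near (riccati_abel_chain F 2) p \<longleftrightarrow>
           (\<exists>V \<alpha> \<beta>. open V \<and> p \<in> V \<and> smooth_on (fst ` V) \<alpha> \<and> smooth_on (fst ` V) \<beta> \<and>
              (\<forall>(x, y)\<in>V. F (x, y) = \<alpha> x * y + \<beta> x)))
        \<and>
        (linearizable_near (riccati_abel_chain F 2) p \<longleftrightarrow>
           (\<exists>V \<rho> \<psi> K \<alpha>. p \<in> V \<and> point_transformation V \<rho> \<psi> \<and>
              open K \<and> \<rho> ` V \<subseteq> K \<and> smooth_on K \<alpha> \<and>
              maps_ode V \<rho> \<psi> (riccati_abel_chain F 2)
                (riccati_abel_chain (\<lambda>(z, w). \<alpha> z * w) 2))))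
     \<and>
     (\<forall>(\<alpha> :: real \<Rightarrow> real) I. open I \<and> smooth_on I \<alpha> \<longrightarrow>
        (\<forall>I' y. open I' \<and> I' \<subseteq> I \<and> Ck_on 2 I' y \<longrightarrow>
           (\<forall>x\<in>I'. riccati_abel_chain (\<lambda>(x, y). \<alpha> x * y) 2 y x \<longleftrightarrow>
              deriv (deriv y) x + 3 * \<alpha> x * y x * deriv y x
              + deriv \<alpha> x * (y x)\<^sup>2 + (\<alpha> x)\<^sup>2 * (y x) ^ 3 = 0))
        \<and>
        (\<forall>k1 k2 k3 k4 k5 k6 T S. k3 * k6 \<noteq> 0 \<and> k5 \<noteq> 1 \<and> k5 \<notin> I \<and>
           (\<forall>x\<in>I. (T has_real_derivative (k5 - x) * \<alpha> x / k3) (at x)) \<and>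
           (\<forall>x\<in>I. (S has_real_derivative k6 * (k1 - T x) / (k5 - x)\<^sup>2) (at x)) \<longrightarrow>
           point_transformation (I \<times> {y. y \<noteq> 0})
             (family_rho k1 k3 k5 T) (family_psi k1 k2 k3 k4 k5 k6 T S) \<and>
           maps_ode (I \<times> {y. y \<noteq> 0})
             (family_rho k1 k3 k5 T) (family_psi k1 k2 k3 k4 k5 k6 T S)
             (riccati_abel_chain (\<lambda>(x, y). \<alpha> x * y) 2) free_particle_ode))"
proof (intro conjI)
  show "\<forall>I y. open I \<and> Ck_on 2 I y \<and> (\<forall>x\<in>I. (x, y x) \<in> U) \<longrightarrow>
        (\<forall>x\<in>I. riccati_abel_chain F 2 y x \<longleftrightarrow>
           deriv (deriv y) x
           + (2 * F (x, y x) + y x * pdy F (x, y x)) * deriv y x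
           + y x * ((F (x, y x))\<^sup>2 + pdx F (x, y x)) = 0)"
    using Omega_iterates(3,4)[OF assms] by (intro allI impI ballI) (elim conjE, simp only:)
next
  show "\<forall>p\<in>U.
        (linearizable_near (riccati_abel_chain F 2) p \<longleftrightarrow>
           (\<exists>V \<alpha> \<beta>. open V \<and> p \<in> V \<and> smooth_on (fst ` V) \<alpha> \<and> smooth_on (fst ` V) \<beta> \<and>
              (\<forall>(x, y)\<in>V. F (x, y) = \<alpha> x * y + \<beta> x)))
        \<and>
        (linearizable_near (riccati_abel_chain F 2) p \<longleftrightarrow>
           (\<exists>V \<rho> \<psi> K \<alpha>. p \<in> V \<and> point_transformation V \<rho> \<psi> \<and>
              open K \<and> \<rho> ` V \<subseteq> K \<and> smooth_on K \<alpha> \<and>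
              maps_ode V \<rho> \<psi> (riccati_abel_chain F 2)
                (riccati_abel_chain (\<lambda>(z, w). \<alpha> z * w) 2)))"
    (is "\<forall>p\<in>U. (?lin p \<longleftrightarrow> ?affine p) \<and> (?lin p \<longleftrightarrow> ?reducible p)")
  proof
    fix p assume p: "p \<in> U"
    have "?lin p \<Longrightarrow> ?affine p"
      unfolding linearizable_near_def
      by (elim exE conjE) (rule linear_ode_imp_affine[OF assms p])
    moreover have "?reducible p \<Longrightarrow> ?affine p"
      by (elim exE conjE) (rule linear_coefficient_imp_affine[OF assms p])
    moreover have "?lin p \<and> ?reducible p" if "?affine p"
    proof -
      obtain x0 y0 where xy: "p = (x0, y0)" by (cases p)
      from that obtain V \<alpha> \<beta> where V: "open V" "p \<in> V" "smooth_on (fst ` V) \<alpha>" "smooth_on (fst ` V) \<beta>"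
        "\<forall>(x, y)\<in>V. F (x, y) = \<alpha> x * y + \<beta> x" by (elim exE conjE) (rule that)
      note V = V(1) V(2)[unfolded xy] V(3-5)
      show ?thesis
        unfolding xy by (rule conjI[OF affine_imp_linearizable[OF V] affine_imp_linear_coefficient[OF V]])
    qed
    ultimately show "(?lin p \<longleftrightarrow> ?affine p) \<and> (?lin p \<longleftrightarrow> ?reducible p)" by blast
  qed
next
  show "\<forall>(\<alpha> :: real \<Rightarrow> real) I. open I \<and> smooth_on I \<alpha> \<longrightarrow>
        (\<forall>I' y. open I' \<and> I' \<subseteq> I \<and> Ck_on 2 I' y \<longrightarrow>
           (\<forall>x\<in>I'. riccati_abel_chain (\<lambda>(x, y). \<alpha> x * y) 2 y x \<longleftrightarrow>
              deriv (deriv y) x + 3 * \<alpha> x * y x * deriv y x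
              + deriv \<alpha> x * (y x)\<^sup>2 + (\<alpha> x)\<^sup>2 * (y x) ^ 3 = 0))
        \<and>
        (\<forall>k1 k2 k3 k4 k5 k6 T S. k3 * k6 \<noteq> 0 \<and> k5 \<noteq> 1 \<and> k5 \<notin> I \<and>
           (\<forall>x\<in>I. (T has_real_derivative (k5 - x) * \<alpha> x / k3) (at x)) \<and>
           (\<forall>x\<in>I. (S has_real_derivative k6 * (k1 - T x) / (k5 - x)\<^sup>2) (at x)) \<longrightarrow>
           point_transformation (I \<times> {y. y \<noteq> 0})
             (family_rho k1 k3 k5 T) (family_psi k1 k2 k3 k4 k5 k6 T S) \<and>
           maps_ode (I \<times> {y. y \<noteq> 0})
             (family_rho k1 k3 k5 T) (family_psi k1 k2 k3 k4 k5 k6 T S)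
             (riccati_abel_chain (\<lambda>(x, y). \<alpha> x * y) 2) free_particle_ode)"
  proof (intro allI impI conjI ballI; elim conjE)
    fix \<alpha> y :: "real \<Rightarrow> real" and I I' x
    assume "open I" "smooth_on I \<alpha>" "open I'" "I' \<subseteq> I" "Ck_on 2 I' y" "x \<in> I'"
    then show "riccati_abel_chain (\<lambda>(x, y). \<alpha> x * y) 2 y x \<longleftrightarrow>
        deriv (deriv y) x + 3 * \<alpha> x * y x * deriv y x + deriv \<alpha> x * (y x)\<^sup>2 + (\<alpha> x)\<^sup>2 * y x ^ 3 = 0"
      by (rule chain_linear_coefficient)
  qed (rule family_linearizes; assumption)+
qed

end
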